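(* Let $(A,\mathbf{T},\alpha)$ be a C*-dynamical system with $\alpha\neq \mathrm{id}$ (that is, $\alpha$ is a non-trivial action). Then the following conditions are equivalent: (i) There exists a non-zero closed two-sided ideal $J\subset A^{\alpha}$ which is a simple C*-algebra and such that $\overline{A_{n}A_{-n}}=J$ for every $n\in sp(\alpha)$ with $n\geq 1$. (ii) $A^{\alpha}([0,\infty))$ is a maximal norm-closed subalgebra of $A$, i.e. if $B\subseteq A$ is a norm-closed subalgebra with $A^{\alpha}([0,\infty))\subsetneq B$, then $B=A$.
   Context: $\mathbf{T}=\{z\in\mathbf{C}: |z|=1\}$. A C*-dynamical system $(A,\mathbf{T},\alpha)$ consists of a C*-algebra $A$ (not assumed unital) and a homomorphism $\alpha:\mathbf{T}\to \mathrm{Aut}(A)$ such that $z\mapsto\alpha_z(x)$ is norm-continuous for every $x\in A$. For $n\in\mathbf{Z}$ put $A_n=\{x\in A: \alpha_z(x)=z^n x \text{ for all } z\in\mathbf{T}\}$; in particular $A^{\alpha}=A_0$ is the fixed point algebra. One has $A_nA_m\subset A_{n+m}$ and $A_{-n}=A_n^*$. The Arveson spectrum of $\alpha$ is $sp(\alpha)=\{n\in\mathbf{Z}: A_n\neq\{0\}\}$. The algebra of analytic elements $A^{\alpha}([0,\infty))$ is the norm-closed linear span of $\bigcup\{A_n: n\in sp(\alpha),\ n\geq 0\}$. For subspaces $X,Y\subset A$, $XY$ denotes the set of finite sums of products $xy$ with $x\in X$, $y\in Y$, and the bar denotes norm closure; thus $\overline{A_nA_{-n}}$ is a closed two-sided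 ideal of $A^{\alpha}$. Subalgebras are not assumed to be self-adjoint. *)

theory Defs
  imports "HOL-Analysis.Analysis"
begin

text \<open>
  C*-algebras are complex and not assumed to be unital. The algebra is the whole type, so
  its subalgebras and ideals are sets of elements of that type.
\<close>

class cstar_algebra = real_normed_algebra + banach +
  fixes scaleC :: "complex \<Rightarrow> 'a \<Rightarrow> 'a"  (infixr \<open>*\<^sub>C\<close> 75)
    and star :: "'a \<Rightarrow> 'a"
  assumes scaleC_add_right: "a *\<^sub>C (x + y) = a *\<^sub>C x + a *\<^sub>C y"
    and scaleC_add_left: "(a + b) *\<^sub>C x = a *\<^sub>C x + b *\<^sub>C x"
    and scaleC_scaleC: "a *\<^sub>C b *\<^sub>C x = (a * b) *\<^sub>C x"
    and scaleR_scaleC: "r *\<^sub>R x = of_real r *\<^sub>C x"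
    and mult_scaleC_left: "(a *\<^sub>C x) * y = a *\<^sub>C (x * y)"
    and mult_scaleC_right: "x * (a *\<^sub>C y) = a *\<^sub>C (x * y)"
    and norm_scaleC: "norm (a *\<^sub>C x) = cmod a * norm x"
    and star_star: "star (star x) = x"
    and star_add: "star (x + y) = star x + star y"
    and star_scaleC: "star (a *\<^sub>C x) = cnj a *\<^sub>C star x"
    and star_mult: "star (x * y) = star y * star x"
    and cstar_identity: "norm (star x * x) = (norm x)\<^sup>2"

lemma scaleC_one: "1 *\<^sub>C x = (x :: 'a :: cstar_algebra)"
  using scaleR_scaleC[of 1 x] by simp

global_interpretation complex_vector:
  vector_space "scaleC :: complex \<Rightarrow> 'a \<Rightarrow> 'a :: cstar_algebra"
  defines csubspace = complex_vector.subspace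
    and cspan = complex_vector.span
  by unfold_locales (simp_all add: scaleC_add_right scaleC_add_left scaleC_scaleC scaleC_one)

definition closed_subalgebra :: "'a :: cstar_algebra set \<Rightarrow> bool" where
  "closed_subalgebra B \<longleftrightarrow>
     csubspace B \<and> closed B \<and> (\<forall>x\<in>B. \<forall>y\<in>B. x * y \<in> B)"

definition closed_ideal :: "'a :: cstar_algebra set \<Rightarrow> 'a set \<Rightarrow> bool" where
  "closed_ideal J R \<longleftrightarrow>
     J \<subseteq> R \<and> csubspace J \<and> closed J \<and> (\<forall>a\<in>R. \<forall>x\<in>J. a * x \<in> J \<and> x * a \<in> J)"

definition simple_cstar_algebra :: "'a :: cstar_algebra set \<Rightarrow> bool" where
  "simple_cstar_algebra J \<longleftrightarrow>
     closed_subalgebra J \<and> (\<forall>x\<in>J. star x \<in> J) \<and> J \<noteq> {0} \<and>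
     (\<forall>I. closed_ideal I J \<longrightarrow> I = {0} \<or> I = J)"

text \<open>
  Maximality is among all norm-closed subalgebras, which need be neither self-adjoint nor
  unital. Properness of \<open>S\<close> is not part of the notion.
\<close>

definition maximal_closed_subalgebra :: "'a :: cstar_algebra set \<Rightarrow> bool" where
  "maximal_closed_subalgebra S \<longleftrightarrow>
     closed_subalgebra S \<and> (\<forall>B. closed_subalgebra B \<and> S \<subset> B \<longrightarrow> B = UNIV)"

definition set_product :: "'a :: cstar_algebra set \<Rightarrow> 'a set \<Rightarrow> 'a set" where
  "set_product X Y =
     {\<Sum>i<k. x i * y i | (k :: nat) x y. \<forall>i<k. x i \<in> X \<and> y i \<in> Y}"

definition star_automorphism :: "('a :: cstar_algebra \<Rightarrow> 'a) \<Rightarrow> bool" where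
  "star_automorphism f \<longleftrightarrow>
     bij f \<and>
     (\<forall>x y. f (x + y) = f x + f y) \<and>
     (\<forall>c x. f (c *\<^sub>C x) = c *\<^sub>C f x) \<and>
     (\<forall>x y. f (x * y) = f x * f y) \<and>
     (\<forall>x. f (star x) = star (f x))"

text \<open>
  An action of the circle group is a function on all complex numbers of which only the values
  on the unit circle matter.
\<close>

locale cstar_dynamical_system =
  fixes \<alpha> :: "complex \<Rightarrow> 'a :: cstar_algebra \<Rightarrow> 'a"
  assumes automorphism: "z \<in> sphere 0 1 \<Longrightarrow> star_automorphism (\<alpha> z)"
    and action_mult:
      "z \<in> sphere 0 1 \<Longrightarrow> w \<in> sphere 0 1 \<Longrightarrow> \<alpha> (z * w) = \<alpha> z \<circ> \<alpha> w"
    and norm_continuous: "continuous_on (sphere 0 1) (\<lambda>z. \<alpha> z x)"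

definition spectral_subspace :: "(complex \<Rightarrow> 'a :: cstar_algebra \<Rightarrow> 'a) \<Rightarrow> int \<Rightarrow> 'a set" where
  "spectral_subspace \<alpha> n = {x. \<forall>z\<in>sphere 0 1. \<alpha> z x = (z powi n) *\<^sub>C x}"

definition fixed_point_algebra :: "(complex \<Rightarrow> 'a :: cstar_algebra \<Rightarrow> 'a) \<Rightarrow> 'a set" where
  "fixed_point_algebra \<alpha> = spectral_subspace \<alpha> 0"

definition arveson_spectrum :: "(complex \<Rightarrow> 'a :: cstar_algebra \<Rightarrow> 'a) \<Rightarrow> int set" where
  "arveson_spectrum \<alpha> = {n. spectral_subspace \<alpha> n \<noteq> {0}}"

definition analytic_elements :: "(complex \<Rightarrow> 'a :: cstar_algebra \<Rightarrow> 'a) \<Rightarrow> 'a set" where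
  "analytic_elements \<alpha> =
     closure (cspan (\<Union>n\<in>{n \<in> arveson_spectrum \<alpha>. n \<ge> 0}. spectral_subspace \<alpha> n))"

end

theory Submission
  imports Defs
begin

text \<open>
  Write \<open>A\<^sub>n\<close> for the spectral subspaces, \<open>x\<^sub>n \<in> A\<^sub>n\<close> for the Fourier coefficients of \<open>x\<close>, \<open>S\<close> for
  the algebra of analytic elements, \<open>J\<^sub>n\<close> for the closed span of \<open>A\<^sub>n A\<^sub>-\<^sub>n\<close>, and let \<open>d\<close> be the
  least positive degree with \<open>A\<^sub>d \<noteq> {0}\<close>. It exists because the action is non-trivial. The elements of
  \<open>S\<close> are those without negative coefficients, since every \<open>x\<close> is a limit of linear combinations
  of its coefficients (\<open>mem_closed_span_spectral_projections\<close>).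

  From a simple ideal to maximality, the argument is a non-commutative version of Cohen's proof of
  Wermer's maximality theorem. Let \<open>B\<close> be a closed algebra larger than \<open>S\<close> and let \<open>R\<close> be the
  closed right ideal of \<open>B\<close> spanned by \<open>A\<^sub>d B\<close>. Some \<open>b \<in> B\<close> has a non-zero coefficient of
  degree \<open>- d\<close>; simplicity of \<open>J\<close> then shows that every element of \<open>J\<close> is a limit of
  zeroth coefficients of elements \<open>v\<close> of \<open>R\<close>
  (\<open>closed_ideal_generated_by_coefficient\<close>). Subtracting from \<open>v\<close> its components of positive
  degree, and the adjoints of those of negative degree, leaves the zeroth coefficient plus a
  skew-adjoint element; all that is subtracted lies in the closed span of \<open>A\<^sub>d S\<close>, hence in
  \<open>R\<close> (\<open>real_part_correction\<close>). So for \<open>x \<in> J\<close> the right ideal contains elements \<open>C\<close> whose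
  real part is arbitrarily close to the positive element \<open>(x x\<^sup>*)\<^sup>2\<close>, with no control of the
  imaginary part. In the scalar case such a \<open>C\<close> is invertible. Here one solves \<open>t y + C y = x\<close> in
  \<open>B\<close> and finds that \<open>t y\<close> tends to \<open>0\<close> with \<open>t\<close>, at a rate independent of the
  imaginary part, so that \<open>x\<close> is a limit of elements \<open>C y \<in> R\<close>
  (\<open>mem_closed_if_accretive_approximants\<close>). Hence \<open>J \<subseteq> R\<close>, so \<open>A\<^sub>-\<^sub>d\<close>, the closed span of \<open>A\<^sub>-\<^sub>d J\<close>,
  lies in \<open>B\<close>, and the remaining negative subspaces follow by induction.

  For the converse, let \<open>K\<close> be a closed ideal of \<open>A\<^sub>0\<close> that is not annihilated by
  \<open>A\<^sub>-\<^sub>d\<close>. The elements \<open>y\<close> for which left multiplication by \<open>y\<close> preserves the set of all \<open>x\<close> with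
  \<open>x\<^sub>-\<^sub>m\<close> in the closed span of \<open>A\<^sub>-\<^sub>m K\<close> for every \<open>m \<ge> 1\<close> form a closed algebra that contains
  \<open>S\<close> and \<open>A\<^sub>-\<^sub>d K\<close>; the latter because there are no degrees strictly between \<open>0\<close> and
  \<open>d\<close>. By maximality it is everything, which forces \<open>A\<^sub>-\<^sub>m\<close> into the closed span of \<open>A\<^sub>-\<^sub>m K\<close> and
  therefore \<open>J\<^sub>m \<subseteq> K\<close> for all \<open>m \<ge> 1\<close> (\<open>ideal_contains_products\<close>). Taking for \<open>K\<close> the
  ideals \<open>J\<^sub>d\<close> and \<open>J\<^sub>m\<close> shows that they coincide, and taking \<open>J I J\<close> for an ideal \<open>I\<close> of
  \<open>J\<close> shows that \<open>J\<close> is simple.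

  The C*-algebra theory behind this is elementary: the square root of \<open>1 - g\<^sup>2\<close> for
  self-adjoint \<open>g\<close> of norm less than one replaces spectral theory, continuous functional calculus
  and approximate units.
\<close>

section \<open>Adjoints and scalars in a C*-algebra\<close>

lemma scaleC_minus_left: "(- a) *\<^sub>C x = - (a *\<^sub>C (x :: 'a :: cstar_algebra))"
  by (rule complex_vector.scale_minus_left)

lemma bounded_bilinear_scaleC:
  "bounded_bilinear (scaleC :: complex \<Rightarrow> 'a \<Rightarrow> 'a :: cstar_algebra)"
proof (unfold_locales)
  show "\<exists>K. \<forall>a b. norm (a *\<^sub>C (b::'a)) \<le> norm a * norm b * K"
    by (rule exI[of _ 1]) (simp add: norm_scaleC)
qed (simp_all add: scaleC_add_left scaleC_add_right scaleR_scaleC scaleC_scaleC scaleR_conv_of_real mult.commute)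

lemmas bounded_linear_scaleC_right = bounded_bilinear.bounded_linear_right[OF bounded_bilinear_scaleC]
lemmas continuous_on_scaleC [continuous_intros] =
  bounded_bilinear.continuous_on[OF bounded_bilinear_scaleC]

lemma star_scaleR: "star (r *\<^sub>R x) = r *\<^sub>R star (x :: 'a :: cstar_algebra)"
  by (simp add: scaleR_scaleC star_scaleC)

lemma norm_star [simp]: "norm (star x) = norm (x :: 'a :: cstar_algebra)"
proof -
  have le: "norm x \<le> norm (star x)" for x :: 'a
  proof (cases "x = 0")
    case False
    have "norm x * norm x \<le> norm (star x) * norm x"
      using cstar_identity[of x] norm_mult_ineq[of "star x" x] by (simp add: power2_eq_square)
    with False show ?thesis by simp
  qed simp
  show ?thesis using le[of x] le[of "star x"] by (simp add: star_star)
qed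

lemma bounded_linear_star: "bounded_linear (star :: 'a \<Rightarrow> 'a :: cstar_algebra)"
  by (rule bounded_linear_intro[of _ 1]) (simp_all add: star_add star_scaleR)

lemma star_zero [simp]: "star 0 = (0 :: 'a :: cstar_algebra)"
  and star_minus: "star (- x) = - star (x :: 'a)"
  and star_diff: "star (x - y) = star x - star (y :: 'a)"
proof -
  interpret bounded_linear "star :: 'a \<Rightarrow> 'a" by (rule bounded_linear_star)
  show "star 0 = (0 :: 'a)" "star (- x) = - star x" "star (x - y) = star x - star y"
    by (simp_all add: zero neg diff)
qed

lemmas star_simps = star_add star_diff star_minus star_mult star_star star_scaleC star_scaleR

section \<open>Square roots and contractivity of automorphisms\<close>

lemma norm_sq_le:
  fixes x :: "'a :: cstar_algebra"
  assumes "norm (star x * x) \<le> (K * norm y)\<^sup>2" "0 \<le> K"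
  shows "norm x \<le> K * norm y"
  using assms cstar_identity[of x] by (metis norm_ge_zero mult_nonneg_nonneg power2_le_imp_le)

lemma norm_star_mult_mult_le: "norm (star x * a * y) \<le> norm a * norm x * norm (y :: 'a :: cstar_algebra)"
proof -
  have "norm (star x * a * y) \<le> norm (star x * a) * norm y" by (rule norm_mult_ineq)
  also have "\<dots> \<le> (norm (star x) * norm a) * norm y"
    by (intro mult_right_mono norm_mult_ineq) simp
  finally show ?thesis by (simp add: algebra_simps)
qed

lemma norm_add_add_diff_diff_le:
  "norm (a + b - c - d) \<le> norm a + norm b + norm c + norm (d :: 'a :: real_normed_vector)"
  using norm_triangle_ineq[of a b] norm_triangle_ineq4[of "a + b" c] norm_triangle_ineq4[of "a + b - c" d]
  by linarith

text \<open>
  The element \<open>1 - r\<close> is a square root of \<open>1 - g\<^sup>2\<close>, written without a unit. The equation for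
  \<open>r\<close> says that it is a fixed point of \<open>r \<mapsto> (g\<^sup>2 + r\<^sup>2) / 2\<close>, which contracts the ball of
  radius \<open>norm g\<close>.
\<close>

lemma self_adjoint_square_root_complement:
  fixes g :: "'a :: cstar_algebra"
  assumes "star g = g" "norm g < 1"
  shows "\<exists>r. star r = r \<and> r * g = g * r \<and> r + r = g * g + r * r"
proof -
  define X where "X = {r. norm r \<le> norm g \<and> star r = r \<and> r * g = g * r}"
  define f where "f r = (1/2) *\<^sub>R (g * g + r * r)" for r
  have clX: "closed X"
    unfolding X_def
    by (intro closed_Collect_conj closed_Collect_le closed_Collect_eq continuous_intros
        bounded_linear.continuous_on[OF bounded_linear_star])
  have maps: "f r \<in> X" if "r \<in> X" for r
  proof -
    have r: "norm r \<le> norm g" "star r = r" "r * g = g * r" using that by (auto simp: X_def)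
    have "norm (g * g + r * r) \<le> norm g * norm g + norm r * norm r"
      by (intro norm_triangle_mono norm_mult_ineq)
    also have "\<dots> \<le> norm g * 1 + norm g * 1"
      using r assms by (intro add_mono mult_mono) auto
    finally have "norm (f r) \<le> norm g" by (simp add: f_def)
    moreover have "r * r * g = g * (r * r)" by (metis r(3) mult.assoc)
    ultimately show ?thesis using r assms
      by (simp add: X_def f_def star_simps distrib_left distrib_right mult.assoc)
  qed
  have lip: "dist (f r) (f s) \<le> norm g * dist r s" if "r \<in> X" "s \<in> X" for r s
  proof -
    have "r * r - s * s = r * (r - s) + (r - s) * s" by (simp add: algebra_simps)
    then have "norm (r * r - s * s) \<le> norm r * norm (r - s) + norm (r - s) * norm s"
      by (metis norm_triangle_mono norm_mult_ineq)
    also have "\<dots> \<le> norm g * norm (r - s) + norm (r - s) * norm g"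
      using that by (intro add_mono mult_mono) (auto simp: X_def)
    finally have *: "norm (r * r - s * s) \<le> 2 * (norm g * norm (r - s))" by simp
    have "f r - f s = (1/2) *\<^sub>R (r * r - s * s)" by (simp add: f_def algebra_simps)
    with * show ?thesis by (simp add: dist_norm)
  qed
  have "\<exists>!r. r \<in> X \<and> f r = r"
    using lip maps assms clX
    by (intro Banach_fix[where c = "norm g"]) (auto simp: complete_eq_closed X_def)
  then obtain r where r: "r \<in> X" "f r = r" by blast
  from r(2) have "r + r = 2 *\<^sub>R f r" by (simp add: scaleR_2)
  then have "r + r = g * g + r * r" by (simp add: f_def)
  with r(1) show ?thesis by (auto simp: X_def)
qed

text \<open>
  Formally \<open>g\<^sup>2 + (1 - r)\<^sup>2 = 1\<close> with commuting self-adjoint terms, so \<open>g \<plusminus> \<i> (1 - r)\<close> is unitary and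
  left multiplication by it is isometric. Both \<open>g\<close> and \<open>1 - r\<close> are averages of two
  such unitaries up to a phase, and \<open>1 - g\<^sup>2 = (1 - r)\<^sup>2\<close>.
\<close>

lemma contractive_of_square_sum_one:
  fixes g r z :: "'a :: cstar_algebra"
  assumes "star g = g" "star r = r" "r * g = g * r" "r + r = g * g + r * r"
  shows "norm (g * z) \<le> norm z" "norm (z - r * z) \<le> norm z" "norm (z - g * g * z) \<le> norm z"
proof -
  have iso: "norm (g * z + c *\<^sub>C (z - r * z)) = norm z" if c: "c = \<i> \<or> c = - \<i>" for c z
  proof -
    have "star (g * z + c *\<^sub>C (z - r * z)) * (g * z + c *\<^sub>C (z - r * z))
        = star z * (g * g + z - z) * z + star z * z - star z * (r + r) * z + star z * (r * r) * z
          + c *\<^sub>C (star z * (g * z)) - c *\<^sub>C (star z * (g * r * z))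
          - (c *\<^sub>C (star z * (g * z)) - c *\<^sub>C (star z * (r * g * z)))"
      using c assms(1,2)
      by (auto simp: star_simps algebra_simps mult_scaleC_left mult_scaleC_right scaleC_scaleC
          complex_vector.scale_right_diff_distrib scaleC_add_right scaleC_minus_left scaleC_one)
    also have "\<dots> = star z * z"
      using assms(3,4) by (simp add: algebra_simps)
    finally show ?thesis
      by (metis cstar_identity norm_ge_zero power2_eq_iff_nonneg)
  qed
  have b1: "norm (z - r * z) \<le> norm z" for z
  proof -
    have "2 *\<^sub>R (\<i> *\<^sub>C (z - r * z)) = (g * z + \<i> *\<^sub>C (z - r * z)) - (g * z + (- \<i>) *\<^sub>C (z - r * z))"
      by (simp add: scaleR_2 scaleC_minus_left)
    then have "norm (2 *\<^sub>R (\<i> *\<^sub>C (z - r * z))) \<le> norm z + norm z"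
      using norm_triangle_ineq4 iso by metis
    then show ?thesis by (simp add: norm_scaleC)
  qed
  have "2 *\<^sub>R (g * z) = (g * z + \<i> *\<^sub>C (z - r * z)) + (g * z + (- \<i>) *\<^sub>C (z - r * z))"
    by (simp add: scaleR_2 scaleC_minus_left)
  then have "norm (2 *\<^sub>R (g * z)) \<le> norm z + norm z"
    using norm_triangle_ineq iso by metis
  then show "norm (g * z) \<le> norm z" by simp
  show "norm (z - r * z) \<le> norm z" by (rule b1)
  have "z - g * g * z = (z - r * z) - r * (z - r * z)"
  proof -
    have "g * g * z = (r + r - r * r) * z" using assms(4) by simp
    then show ?thesis by (simp add: algebra_simps)
  qed
  then show "norm (z - g * g * z) \<le> norm z" using b1 order_trans by metis
qed

text \<open>
  A homomorphism carries the identity \<open>g\<^sup>2 + (1 - r)\<^sup>2 = 1\<close> to its target, where it bounds the norm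
  of the image of \<open>g\<close> by one. This avoids the spectral radius formula.
\<close>

lemma star_automorphism_contractive:
  fixes f :: "'a :: cstar_algebra \<Rightarrow> 'a"
  assumes "star_automorphism f"
  shows "norm (f x) \<le> norm x"
proof -
  have f: "f (x + y) = f x + f y" "f (x * y) = f x * f y" "f (star x) = star (f x)"
    "f (c *\<^sub>C x) = c *\<^sub>C f x" for x y c
    using assms by (auto simp: star_automorphism_def)
  have fR: "f (c *\<^sub>R x) = c *\<^sub>R f x" for c x by (simp add: scaleR_scaleC f)
  have unit: "norm (f g) \<le> 1" if g: "star g = g" "norm g < 1" for g
  proof -
    obtain r where r: "star r = r" "r * g = g * r" "r + r = g * g + r * r"
      using self_adjoint_square_root_complement[OF g] by blast
    have "norm (f g * f g) \<le> norm (f g)"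
      by (rule contractive_of_square_sum_one(1)[of "f g" "f r"])
        (use g r in \<open>simp_all flip: f\<close>)
    then have "norm (f g) * norm (f g) \<le> norm (f g)"
      using cstar_identity[of "f g"] g by (simp add: power2_eq_square flip: f(3))
    then show ?thesis
      using mult_le_cancel_right_pos[of "norm (f g)" "norm (f g)" 1]
      by (cases "norm (f g) = 0") auto
  qed
  have sa: "norm (f h) \<le> norm h" if h: "star h = h" for h
  proof (rule field_le_epsilon)
    fix e :: real assume "e > 0"
    then have pos: "norm h + e > 0" by (simp add: add_nonneg_pos)
    have "norm (f (inverse (norm h + e) *\<^sub>R h)) \<le> 1"
      using h pos \<open>e > 0\<close> by (intro unit) (simp_all add: star_scaleR field_simps)
    then show "norm (f h) \<le> norm h + e"
      using pos by (simp add: fR field_simps)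
  qed
  have "(norm (f x))\<^sup>2 = norm (f (star x * x))" by (simp add: f cstar_identity)
  also have "\<dots> \<le> (norm x)\<^sup>2" using sa[of "star x * x"] by (simp add: star_simps cstar_identity)
  finally show ?thesis by (rule power2_le_imp_le) simp
qed

section \<open>Equations with accretive coefficients\<close>

text \<open>
  Suppose that the real part of \<open>C\<close> is close to \<open>g\<^sup>2\<close> and let \<open>W\<close> be its skew-adjoint part. Then
  \<open>1 - e (t + C)\<close> agrees with \<open>(1 - e t) (1 - e g\<^sup>2) (1 - e W)\<close> up to \<open>e t / 2\<close>, which comes from the
  error in the real part, and up to terms of order \<open>e\<^sup>2\<close>. The second factor is contractive and the third has norm at most
  \<open>1 + e\<^sup>2 (norm W)\<^sup>2\<close>, because the term of first order cancels in the C*-identity.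
\<close>

lemma accretive_perturbation_contractive:
  fixes C g :: "'a :: cstar_algebra"
  assumes t: "t > 0" and g: "star g = g" and C: "norm (C + star C - 2 *\<^sub>R (g * g)) \<le> t"
  shows "\<exists>e>0. e * t < 1 \<and> (\<forall>z. norm (z - e *\<^sub>R (t *\<^sub>R z + C * z)) \<le> (1 - e * t / 4) * norm z)"
proof -
  define E where "E = (1/2) *\<^sub>R (C + star C) - g * g"
  define W where "W = (1/2) *\<^sub>R (C - star C)"
  have E: "norm E \<le> t / 2"
  proof -
    have "C + star C - 2 *\<^sub>R (g * g) = 2 *\<^sub>R E" by (simp add: E_def scaleR_diff_right)
    with C show ?thesis by simp
  qed
  have dec: "C = g * g + W + E"
  proof -
    have "g * g + W + E = (1/2) *\<^sub>R C + (1/2) *\<^sub>R C" by (simp add: E_def W_def algebra_simps)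
    then show ?thesis by (simp flip: scaleR_left_distrib)
  qed
  have W: "star W = - W" by (simp add: W_def star_simps scaleR_diff_right)
  define p w where "p = norm (g * g)" and "w = norm W"
  define K where "K = w\<^sup>2 + p * w + t * (w + p + p * w)"
  have pw: "p \<ge> 0" "w \<ge> 0" by (simp_all add: p_def w_def)
  have K: "K \<ge> 0" using pw t by (simp add: K_def)
  \<comment> \<open>Small enough for \<open>sqrt e *\<^sub>R g\<close> to have norm below one and for the terms of order \<open>e\<^sup>2\<close>, collected in \<open>K\<close>, to be at most \<open>e * t / 4\<close>.\<close>
  define e where "e = min (min 1 (1 / (2 * t))) (min (1 / (2 * (1 + (norm g)\<^sup>2))) (t / (4 * (1 + K))))"
  have "1 + (norm g)\<^sup>2 > 0" by (simp add: add_pos_nonneg)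
  then have e0: "e > 0" using t K by (auto simp: e_def)
  have e1: "e \<le> 1" and "e \<le> 1 / (2 * t)" and "e \<le> 1 / (2 * (1 + (norm g)\<^sup>2))" and "e \<le> t / (4 * (1 + K))"
    by (auto simp: e_def)
  then have e2: "e * t \<le> 1/2" and eg: "e * (1 + (norm g)\<^sup>2) \<le> 1/2" and eK: "e * (1 + K) \<le> t / 4"
    using t K \<open>1 + (norm g)\<^sup>2 > 0\<close> by (simp_all add: field_simps)
  have g1: "norm (u - e *\<^sub>R (g * g * u)) \<le> norm u" for u
  proof -
    define h where "h = sqrt e *\<^sub>R g"
    have hs: "star h = h" by (simp add: h_def star_scaleR g)
    have "(norm h)\<^sup>2 = e * (norm g)\<^sup>2" using e0 by (simp add: h_def power_mult_distrib)
    also have "\<dots> < 1\<^sup>2" using eg e0 by (simp add: algebra_simps)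
    finally have "norm h < 1" by (rule power2_less_imp_less) simp
    then obtain r where "star r = r" "r * h = h * r" "r + r = h * h + r * r"
      using self_adjoint_square_root_complement[OF hs] by blast
    from contractive_of_square_sum_one(3)[OF hs this, of u] show ?thesis
      using e0 by (simp add: h_def)
  qed
  have main: "norm (z - e *\<^sub>R (t *\<^sub>R z + C * z)) \<le> (1 - e * t / 4) * norm z" for z
  proof -
    define u where "u = z - e *\<^sub>R (W * z)"
    have nW: "norm (W * z) \<le> w * norm z" by (simp add: w_def norm_mult_ineq)
    have ngW: "norm (g * g * W * z) \<le> p * w * norm z"
    proof -
      have "norm (g * g * W * z) \<le> norm (g * g) * norm (W * z)" 
        by (metis norm_mult_ineq mult.assoc)
      also have "\<dots> \<le> p * (w * norm z)" unfolding p_def by (intro mult_left_mono nW) simp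
      finally show ?thesis by simp
    qed
    have u: "norm u \<le> (1 + e\<^sup>2 * w\<^sup>2) * norm z"
    proof (rule norm_sq_le)
      have "star u * u = star z * z - (e\<^sup>2) *\<^sub>R (star z * (W * W) * z)"
        by (simp add: u_def star_simps W algebra_simps power2_eq_square)
      then have "norm (star u * u) \<le> norm (star z * z) + e\<^sup>2 * norm (star z * (W * W) * z)"
        by (metis norm_triangle_ineq4 norm_scaleR abs_power2)
      also have "\<dots> \<le> (norm z)\<^sup>2 + e\<^sup>2 * (w\<^sup>2 * norm z * norm z)"
      proof (intro add_mono mult_left_mono)
        have "norm (star z * (W * W) * z) \<le> norm (W * W) * norm z * norm z"
          by (rule norm_star_mult_mult_le)
        also have "\<dots> \<le> w\<^sup>2 * norm z * norm z"
          by (intro mult_right_mono) (auto simp: w_def power2_eq_square norm_mult_ineq)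
        finally show "norm (star z * (W * W) * z) \<le> w\<^sup>2 * norm z * norm z" .
      qed (simp_all add: cstar_identity)
      also have "\<dots> = (1 + e\<^sup>2 * w\<^sup>2) * (norm z)\<^sup>2" by (simp add: power2_eq_square algebra_simps)
      also have "\<dots> \<le> (1 + e\<^sup>2 * w\<^sup>2)\<^sup>2 * (norm z)\<^sup>2"
        by (intro mult_right_mono self_le_power) auto
      finally show "norm (star u * u) \<le> ((1 + e\<^sup>2 * w\<^sup>2) * norm z)\<^sup>2" by (simp add: power_mult_distrib)
    qed simp
    define v where "v = u - e *\<^sub>R (g * g * u)"
    have v: "norm v \<le> (1 + e\<^sup>2 * w\<^sup>2) * norm z" unfolding v_def using g1 u order_trans by blast
    have vz: "v - z = - (e *\<^sub>R (W * z)) - e *\<^sub>R (g * g * z) + (e\<^sup>2) *\<^sub>R (g * g * W * z)"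
      by (simp add: v_def u_def algebra_simps power2_eq_square)
    have nvz: "norm (v - z) \<le> e * (w + p + p * w) * norm z"
    proof -
      have "norm (v - z) \<le> norm (e *\<^sub>R (W * z)) + norm (e *\<^sub>R (g * g * z)) + norm ((e\<^sup>2) *\<^sub>R (g * g * W * z))"
        using norm_add_add_diff_diff_le[of 0 "(e\<^sup>2) *\<^sub>R (g * g * W * z)" "e *\<^sub>R (W * z)" "e *\<^sub>R (g * g * z)"]
        by (simp add: vz algebra_simps)
      also have "\<dots> \<le> e * (w * norm z) + e * (p * norm z) + e * (p * w * norm z)"
      proof (intro add_mono)
        show "norm (e *\<^sub>R (W * z)) \<le> e * (w * norm z)" using e0 nW by simp
        show "norm (e *\<^sub>R (g * g * z)) \<le> e * (p * norm z)" using e0 by (simp add: p_def norm_mult_ineq)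
        have "norm ((e\<^sup>2) *\<^sub>R (g * g * W * z)) \<le> e\<^sup>2 * (p * w * norm z)"
          using ngW by (simp add: mult_left_mono)
        also have "\<dots> \<le> e * (p * w * norm z)"
          using e0 e1 pw by (intro mult_right_mono) (auto simp: power2_eq_square)
        finally show "norm ((e\<^sup>2) *\<^sub>R (g * g * W * z)) \<le> e * (p * w * norm z)" .
      qed
      finally show ?thesis by (simp add: algebra_simps)
    qed
    have split: "z - e *\<^sub>R (t *\<^sub>R z + C * z)
        = (1 - e * t) *\<^sub>R v + (e * t) *\<^sub>R (v - z) - (e\<^sup>2) *\<^sub>R (g * g * W * z) - e *\<^sub>R (E * z)"
      unfolding dec by (simp add: v_def u_def algebra_simps power2_eq_square)
    have "norm (z - e *\<^sub>R (t *\<^sub>R z + C * z))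
        \<le> norm ((1 - e * t) *\<^sub>R v) + norm ((e * t) *\<^sub>R (v - z)) + norm ((e\<^sup>2) *\<^sub>R (g * g * W * z)) + norm (e *\<^sub>R (E * z))"
      unfolding split by (rule norm_add_add_diff_diff_le)
    also have "\<dots> \<le> (1 - e * t) * ((1 + e\<^sup>2 * w\<^sup>2) * norm z) + (e * t) * (e * (w + p + p * w) * norm z)
        + e\<^sup>2 * (p * w * norm z) + e * (t / 2 * norm z)"
    proof (intro add_mono)
      show "norm ((1 - e * t) *\<^sub>R v) \<le> (1 - e * t) * ((1 + e\<^sup>2 * w\<^sup>2) * norm z)"
        using e2 v by (simp add: mult_left_mono)
      show "norm ((e * t) *\<^sub>R (v - z)) \<le> (e * t) * (e * (w + p + p * w) * norm z)"
        using e0 t nvz by (simp add: abs_mult mult_left_mono)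
      show "norm ((e\<^sup>2) *\<^sub>R (g * g * W * z)) \<le> e\<^sup>2 * (p * w * norm z)"
        using ngW by (simp add: mult_left_mono)
      have "norm (E * z) \<le> t / 2 * norm z"
        using norm_mult_ineq[of E z] E by (meson mult_right_mono norm_ge_zero order_trans)
      then show "norm (e *\<^sub>R (E * z)) \<le> e * (t / 2 * norm z)" using e0 by simp
    qed
    also have "\<dots> = (1 - e * t / 2 + e * (e * K) - e * t * (e\<^sup>2 * w\<^sup>2)) * norm z"
      by (simp add: K_def algebra_simps power2_eq_square)
    also have "\<dots> \<le> (1 - e * t / 2 + e * (t / 4)) * norm z"
    proof (intro mult_right_mono)
      have "e * K \<le> t / 4" using eK e0 by (simp add: algebra_simps)
      then have "e * (e * K) \<le> e * (t / 4)" using e0 by (intro mult_left_mono) auto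
      moreover have "0 \<le> e * t * (e\<^sup>2 * w\<^sup>2)" using e0 t by simp
      ultimately show "1 - e * t / 2 + e * (e * K) - e * t * (e\<^sup>2 * w\<^sup>2) \<le> 1 - e * t / 2 + e * (t / 4)" by linarith
    qed simp
    also have "\<dots> = (1 - e * t / 4) * norm z" by (simp add: algebra_simps)
    finally show ?thesis .
  qed
  show ?thesis using e0 e2 main by (intro exI[of _ e]) auto
qed

text \<open>
  The solution is the fixed point of \<open>y \<mapsto> y - e (t y + C y - x)\<close> in \<open>V\<close>. Its norm is bounded
  independently of the size of \<open>C\<close>.
\<close>

lemma accretive_equation_solvable:
  fixes C g x :: "'a :: cstar_algebra"
  assumes t: "t > 0" and g: "star g = g" and C: "norm (C + star C - 2 *\<^sub>R (g * g)) \<le> t"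
    and V: "csubspace V" "closed V" "\<And>y. y \<in> V \<Longrightarrow> C * y \<in> V" "x \<in> V"
  obtains y where "y \<in> V" "t *\<^sub>R y + C * y = x" "norm y \<le> 4 / t * norm x"
proof -
  obtain e where e: "e > 0" "e * t < 1"
    and ctr: "\<And>z. norm (z - e *\<^sub>R (t *\<^sub>R z + C * z)) \<le> (1 - e * t / 4) * norm z"
    using accretive_perturbation_contractive[OF t g C] by blast
  define f where "f y = y - e *\<^sub>R (t *\<^sub>R y + C * y - x)" for y
  have "\<exists>!y. y \<in> V \<and> f y = y"
  proof (rule Banach_fix[where c = "1 - e * t / 4"])
    show "complete V" using V by (simp add: complete_eq_closed)
    show "V \<noteq> {}" using V by auto
    show "0 \<le> 1 - e * t / 4" "1 - e * t / 4 < 1" using e t by auto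
    show "f ` V \<subseteq> V"
      using V(3,4) by (auto simp: f_def scaleR_scaleC intro!: complex_vector.subspace_diff[OF V(1)]
          complex_vector.subspace_scale[OF V(1)] complex_vector.subspace_add[OF V(1)])
    fix y z
    have "f y - f z = (y - z) - e *\<^sub>R (t *\<^sub>R (y - z) + C * (y - z))"
      by (simp add: f_def algebra_simps)
    then show "dist (f y) (f z) \<le> (1 - e * t / 4) * dist y z"
      using ctr[of "y - z"] by (simp add: dist_norm)
  qed
  then obtain y where y: "y \<in> V" "f y = y" by blast
  then have eq: "t *\<^sub>R y + C * y = x" using e by (simp add: f_def)
  have "norm y \<le> norm (y - e *\<^sub>R x) + norm (e *\<^sub>R x)" using norm_triangle_ineq[of "y - e *\<^sub>R x" "e *\<^sub>R x"] by simp
  also have "\<dots> \<le> (1 - e * t / 4) * norm y + e * norm x" using ctr[of y] e by (simp add: eq)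
  finally have "e * (t / 4 * norm y) \<le> e * norm x" by (simp add: algebra_simps)
  then have "norm y \<le> 4 / t * norm x" using e t by (simp add: field_simps)
  with y eq show ?thesis using that by blast
qed

text \<open>
  If \<open>t y + C y = x\<close>, then \<open>C y\<close> differs from \<open>x\<close> by \<open>t y\<close>, so it is enough that \<open>t y \<rightarrow> 0\<close> as
  \<open>t \<rightarrow> 0\<close>. The solvability estimate alone only bounds \<open>t y\<close>. The gain comes from the dual equation
  \<open>t q + C\<^sup>* q = y\<close>: it gives \<open>y\<^sup>* y = x\<^sup>* q\<close>, while the real part of \<open>q\<^sup>* y\<close> controls \<open>g q\<close> for
  \<open>g = x x\<^sup>*\<close>. Together these bound the fourth power of \<open>norm (t y)\<close> by a multiple of \<open>t\<close>.
  The square of \<open>x x\<^sup>*\<close> is used, and not \<open>x x\<^sup>*\<close> itself, because the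
  contraction estimates above are for squares of self-adjoint elements.
\<close>

lemma mem_closed_if_accretive_approximants:
  fixes x :: "'a :: cstar_algebra"
  assumes V: "csubspace V" "closed V" "x \<in> V" and R: "closed R"
    and C: "\<And>\<eta>. \<eta> > 0 \<Longrightarrow> \<exists>C. norm (C + star C - 2 *\<^sub>R (x * star x * (x * star x))) \<le> \<eta>
              \<and> (\<forall>y\<in>V. C * y \<in> V \<and> C * y \<in> R)"
  shows "x \<in> R"
proof -
  define g where "g = x * star x"
  have g: "star g = g" by (simp add: g_def star_simps)
  have "\<exists>z\<in>R. (dist z x)^4 \<le> 448 * t" if t: "t > 0" for t :: real
  proof -
    obtain C where C: "norm (C + star C - 2 *\<^sub>R (g * g)) \<le> t"
      and CV: "\<And>y. y \<in> V \<Longrightarrow> C * y \<in> V" "\<And>y. y \<in> V \<Longrightarrow> C * y \<in> R"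
      using C[OF t] unfolding g_def by blast
    obtain y where y: "y \<in> V" "t *\<^sub>R y + C * y = x"
      using accretive_equation_solvable[OF t g C V(1,2) CV(1) V(3)] by blast
    have C': "norm (star C + star (star C) - 2 *\<^sub>R (g * g)) \<le> t"
      using C by (simp add: star_star add.commute)
    obtain q where q: "t *\<^sub>R q + star C * q = y" and nq: "norm q \<le> 4 / t * norm y"
      using accretive_equation_solvable[OF t g C' complex_vector.subspace_UNIV closed_UNIV, of y] by blast
    have "star y * y = star y * (t *\<^sub>R q + star C * q)" by (simp add: q)
    also have "\<dots> = star (t *\<^sub>R y + C * y) * q" by (simp add: star_simps algebra_simps)
    also have "\<dots> = star x * q" by (simp add: y)
    finally have "(norm y)\<^sup>2 = norm (star x * q)" by (metis cstar_identity)
    moreover have "(norm y)^4 = ((norm y)\<^sup>2)\<^sup>2" by simp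
    ultimately have "(norm y)^4 = (norm (star x * q))\<^sup>2" by simp
    also have "\<dots> = norm (star q * (g * q))"
      by (simp add: g_def star_simps mult.assoc flip: cstar_identity)
    also have "\<dots> \<le> norm q * norm (g * q)" using norm_mult_ineq[of "star q"] by simp
    finally have y4: "(norm y)^4 \<le> norm q * norm (g * q)" .
    define F where "F = C + star C - 2 *\<^sub>R (g * g)"
    have "star q * y + star y * q = star q * (t *\<^sub>R q + star C * q) + star (t *\<^sub>R q + star C * q) * q"
      by (simp add: q)
    also have "\<dots> = 2 *\<^sub>R (star (g * q) * (g * q)) + 2 *\<^sub>R (t *\<^sub>R (star q * q)) + star q * F * q"
      by (simp add: star_simps algebra_simps F_def g scaleR_2 flip: scaleR_left_distrib)
    finally have eq: "2 *\<^sub>R (star (g * q) * (g * q))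
        = star q * y + star y * q - 2 *\<^sub>R (t *\<^sub>R (star q * q)) - star q * F * q" by simp
    have "2 * (norm (g * q))\<^sup>2 = norm (2 *\<^sub>R (star (g * q) * (g * q)))" by (simp add: cstar_identity)
    also have "\<dots> \<le> norm (star q * y) + norm (star y * q) + norm (2 *\<^sub>R (t *\<^sub>R (star q * q))) + norm (star q * F * q)"
      unfolding eq by (rule norm_add_add_diff_diff_le)
    also have "\<dots> \<le> norm q * norm y + norm y * norm q + 2 * (t * (norm q)\<^sup>2) + t * norm q * norm q"
    proof (intro add_mono)
      show "norm (star q * y) \<le> norm q * norm y" "norm (star y * q) \<le> norm y * norm q"
        using norm_mult_ineq[of "star q" y] norm_mult_ineq[of "star y" q] by simp_all
      show "norm (2 *\<^sub>R (t *\<^sub>R (star q * q))) \<le> 2 * (t * (norm q)\<^sup>2)" using t by (simp add: cstar_identity)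
      have "norm (star q * F * q) \<le> norm F * norm q * norm q" by (rule norm_star_mult_mult_le)
      also have "\<dots> \<le> t * norm q * norm q" using C by (intro mult_right_mono) (auto simp: F_def)
      finally show "norm (star q * F * q) \<le> t * norm q * norm q" .
    qed
    also have "\<dots> = 2 * (norm q * norm y) + 3 * t * (norm q)\<^sup>2" by (simp add: power2_eq_square)
    also have "\<dots> \<le> 2 * (4 / t * norm y * norm y) + 3 * t * (4 / t * norm y)\<^sup>2"
      using nq t by (intro add_mono mult_left_mono mult_right_mono power_mono) auto
    also have "\<dots> = 56 / t * (norm y)\<^sup>2" using t by (simp add: field_simps power2_eq_square)
    finally have gq: "(norm (g * q))\<^sup>2 \<le> 28 / t * (norm y)\<^sup>2" by simp
    \<comment> \<open>Both factors on the right are at most multiples of \<open>norm y\<close>, which cancels half of the power on the left.\<close>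
    have "((norm y)^4)\<^sup>2 \<le> (norm q * norm (g * q))\<^sup>2" using y4 by (intro power_mono) auto
    also have "\<dots> = (norm q)\<^sup>2 * (norm (g * q))\<^sup>2" by (simp add: power_mult_distrib)
    also have "\<dots> \<le> (4 / t * norm y)\<^sup>2 * (28 / t * (norm y)\<^sup>2)"
      using nq gq by (intro mult_mono power_mono) auto
    also have "\<dots> = 448 / t ^ 3 * (norm y)^4" using t by (simp add: field_simps eval_nat_numeral)
    finally have "(norm y)^4 * (norm y)^4 \<le> 448 / t ^ 3 * (norm y)^4" by (simp add: power2_eq_square)
    then have "(norm y)^4 \<le> 448 / t ^ 3"
    proof (cases "norm y = 0")
      case False
      then have "(norm y)^4 > 0" by simp
      with \<open>(norm y)^4 * (norm y)^4 \<le> _\<close> show ?thesis by (simp only: mult_le_cancel_right_pos)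
    qed (use t in auto)
    then have "(t * norm y)^4 \<le> 448 * t" using t by (simp add: field_simps eval_nat_numeral)
    moreover have "dist (C * y) x = t * norm y"
      using t by (simp add: dist_norm flip: y(2))
    ultimately show ?thesis using CV(2)[OF y(1)] by metis
  qed
  note approx = this
  have "\<exists>z\<in>R. dist z x < e" if "e > 0" for e :: real
  proof -
    define t where "t = (e / 2) ^ 4 / 448"
    have t: "t > 0" using that by (simp add: t_def)
    obtain z where z: "z \<in> R" "(dist z x)^4 \<le> 448 * t"
      using approx[OF t] by blast
    then have "(dist z x)^4 \<le> (e / 2)^4" by (simp add: t_def)
    then have "dist z x \<le> e / 2" using that by (simp add: power_mono_iff)
    with z(1) that show ?thesis by (intro bexI[of _ z]) auto
  qed
  then have "x \<in> closure R" by (simp add: closure_approachable)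
  with R show ?thesis by simp
qed

section \<open>Closed spans and products of subspaces\<close>

lemma csubspace_vimage:
  assumes "csubspace V" "\<And>x y. f (x + y) = f x + f y" "\<And>c x. f (c *\<^sub>C x) = c *\<^sub>C f x" "f 0 = 0"
  shows "csubspace {x. f x \<in> V}"
  using assms by (auto simp: complex_vector.subspace_def)

lemma closed_vimage_bounded_linear: "bounded_linear f \<Longrightarrow> closed V \<Longrightarrow> closed {x. f x \<in> V}"
  using continuous_closed_vimage[of V f] linear_continuous_at by (auto simp: vimage_def)

lemma csubspace_closure:
  assumes "csubspace V"
  shows "csubspace (closure V)"
proof (unfold complex_vector.subspace_def, intro conjI ballI allI)
  show "0 \<in> closure V" using assms complex_vector.subspace_0 closure_subset by blast
  fix x y c assume x: "x \<in> closure V" 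
  then obtain f where f: "\<And>n. f n \<in> V" "f \<longlonglongrightarrow> x" unfolding closure_sequential by metis
  show "c *\<^sub>C x \<in> closure V"
    unfolding closure_sequential
    by (rule exI[of _ "\<lambda>n. c *\<^sub>C f n"])
      (simp add: f complex_vector.subspace_scale[OF assms] bounded_linear.tendsto[OF bounded_linear_scaleC_right])
  assume y: "y \<in> closure V"
  then obtain g where g: "\<And>n. g n \<in> V" "g \<longlonglongrightarrow> y" unfolding closure_sequential by metis
  show "x + y \<in> closure V"
    unfolding closure_sequential
    by (rule exI[of _ "\<lambda>n. f n + g n"])
      (simp add: f g complex_vector.subspace_add[OF assms] tendsto_add)
qed

lemma csubspace_closed_span: "csubspace (closure (cspan X))"
  by (intro csubspace_closure complex_vector.subspace_span)

lemma closed_span_superset: "X \<subseteq> closure (cspan X)"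
  using complex_vector.span_superset closure_subset by blast

lemma closed_span_minimal: "X \<subseteq> V \<Longrightarrow> csubspace V \<Longrightarrow> closed V \<Longrightarrow> closure (cspan X) \<subseteq> V"
  by (simp add: closure_minimal complex_vector.span_minimal)

lemma closed_span_mono: "X \<subseteq> Y \<Longrightarrow> closure (cspan X) \<subseteq> closure (cspan Y)"
  by (intro closure_mono complex_vector.span_mono)

lemma closed_span_map:
  assumes "x \<in> closure (cspan X)" "\<And>x. x \<in> X \<Longrightarrow> f x \<in> V" "csubspace V" "closed V"
    and "bounded_linear f" "\<And>c x. f (c *\<^sub>C x) = c *\<^sub>C f x"
  shows "f x \<in> V"
proof -
  interpret bounded_linear f by fact
  have "closure (cspan X) \<subseteq> {x. f x \<in> V}"
    using assms by (intro closed_span_minimal csubspace_vimage closed_vimage_bounded_linear)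
      (auto simp: add)
  with assms show ?thesis by blast
qed

lemma closed_span_mult_left:
  assumes "x \<in> closure (cspan X)" "\<And>x. x \<in> X \<Longrightarrow> a * x \<in> V" "csubspace V" "closed V"
  shows "a * x \<in> V"
  using assms(1) by (rule closed_span_map) (use assms in \<open>auto simp: mult_scaleC_right bounded_linear_mult_right\<close>)

lemma closed_span_mult_right:
  assumes "x \<in> closure (cspan X)" "\<And>x. x \<in> X \<Longrightarrow> x * a \<in> V" "csubspace V" "closed V"
  shows "x * a \<in> V"
  using assms(1) by (rule closed_span_map) (use assms in \<open>auto simp: mult_scaleC_left bounded_linear_mult_left\<close>)

lemma csubspace_star_image:
  assumes "csubspace V"
  shows "csubspace {x. star x \<in> V}"
  using assms by (auto simp: complex_vector.subspace_def star_simps)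

lemma closed_span_star:
  assumes "x \<in> closure (cspan X)" "\<And>x. x \<in> X \<Longrightarrow> star x \<in> V" "csubspace V" "closed V"
  shows "star x \<in> V"
proof -
  have "closure (cspan X) \<subseteq> {x. star x \<in> V}"
    using assms by (intro closed_span_minimal csubspace_star_image closed_vimage_bounded_linear
        bounded_linear_star) auto
  with assms show ?thesis by blast
qed

definition products :: "'a :: cstar_algebra set \<Rightarrow> 'a set \<Rightarrow> 'a set" (infixr \<open>\<odot>\<close> 70) where
  "X \<odot> Y = closure (cspan {x * y | x y. x \<in> X \<and> y \<in> Y})"

lemma products_mem: "x \<in> X \<Longrightarrow> y \<in> Y \<Longrightarrow> x * y \<in> X \<odot> Y"
  using closed_span_superset[of "{x * y | x y. x \<in> X \<and> y \<in> Y}"] by (auto simp: products_def)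

lemma csubspace_products: "csubspace (X \<odot> Y)"
  and closed_products: "closed (X \<odot> Y)"
  by (simp_all add: products_def csubspace_closed_span)

lemma products_minimal:
  "(\<And>x y. x \<in> X \<Longrightarrow> y \<in> Y \<Longrightarrow> x * y \<in> V) \<Longrightarrow> csubspace V \<Longrightarrow> closed V \<Longrightarrow> X \<odot> Y \<subseteq> V"
  unfolding products_def by (rule closed_span_minimal) auto

text \<open>
  Finite sums of products of elements of \<open>X\<close> and \<open>Y\<close> already form a subspace, as scalars can be
  absorbed into \<open>X\<close>.
\<close>

lemma closure_set_product:
  assumes "csubspace X"
  shows "closure (set_product X Y) = X \<odot> Y"
proof -
  have "cspan {x * y | x y. x \<in> X \<and> y \<in> Y} = set_product X Y"
  proof (rule antisym)
    show "set_product X Y \<subseteq> cspan {x * y | x y. x \<in> X \<and> y \<in> Y}"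
    proof
      fix u assume "u \<in> set_product X Y"
      then obtain k x y where u: "u = (\<Sum>i<k. x i * y i)" "\<forall>i<(k::nat). x i \<in> X \<and> y i \<in> Y"
        unfolding set_product_def by blast
      show "u \<in> cspan {x * y | x y. x \<in> X \<and> y \<in> Y}"
        unfolding u(1) by (rule complex_vector.span_sum, rule complex_vector.span_base) (use u(2) in auto)
    qed
    show "cspan {x * y | x y. x \<in> X \<and> y \<in> Y} \<subseteq> set_product X Y"
    proof (rule complex_vector.span_minimal)
      show "{x * y | x y. x \<in> X \<and> y \<in> Y} \<subseteq> set_product X Y"
      proof clarify
        fix x y assume "x \<in> X" "y \<in> Y"
        then show "x * y \<in> set_product X Y"
          unfolding set_product_def mem_Collect_eq
          by (intro exI[where x = "Suc 0"] exI[where x = "\<lambda>_. x"] exI[where x = "\<lambda>_. y"]) simp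
      qed
      show "csubspace (set_product X Y)"
        unfolding complex_vector.subspace_def
      proof (intro conjI ballI allI)
        show "0 \<in> set_product X Y" unfolding set_product_def by (auto intro!: exI[of _ "0::nat"])
        fix u v c assume "u \<in> set_product X Y"
        then obtain k x y where u: "u = (\<Sum>i<k. x i * y i)" "\<forall>i<(k::nat). x i \<in> X \<and> y i \<in> Y"
          unfolding set_product_def by blast
        have "c *\<^sub>C u = (\<Sum>i<k. (c *\<^sub>C x i) * y i)"
          by (simp add: u complex_vector.scale_sum_right mult_scaleC_left)
        moreover have "\<forall>i<k. c *\<^sub>C x i \<in> X \<and> y i \<in> Y"
          using u(2) complex_vector.subspace_scale[OF assms] by simp
        ultimately show "c *\<^sub>C u \<in> set_product X Y"
          unfolding set_product_def mem_Collect_eq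
          by (intro exI[where x = k] exI[where x = "\<lambda>i. c *\<^sub>C x i"] exI[where x = y]) simp
        assume "v \<in> set_product X Y"
        then obtain l x' y' where v: "v = (\<Sum>i<l. x' i * y' i)" "\<forall>i<(l::nat). x' i \<in> X \<and> y' i \<in> Y"
          unfolding set_product_def by blast
        let ?x = "\<lambda>i. if i < k then x i else x' (i - k)" and ?y = "\<lambda>i. if i < k then y i else y' (i - k)"
        have "(\<Sum>i<k + m. ?x i * ?y i) = u + (\<Sum>i<m. x' i * y' i)" for m
          by (induction m) (simp_all add: u add.assoc)
        then have "u + v = (\<Sum>i<k + l. ?x i * ?y i)" by (simp add: v)
        moreover have "\<forall>i<k + l. ?x i \<in> X \<and> ?y i \<in> Y" using u(2) v(2) by auto
        ultimately show "u + v \<in> set_product X Y"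
          unfolding set_product_def mem_Collect_eq
          by (intro exI[where x = "k + l"] exI[where x = ?x] exI[where x = ?y]) simp
      qed
    qed
  qed
  then show ?thesis by (simp add: products_def)
qed

section \<open>Harmonics and an approximate identity on the circle\<close>

definition harmonic :: "int \<Rightarrow> real \<Rightarrow> complex" where
  "harmonic n t = cis (2 * pi * (of_int n * t))"

lemma norm_harmonic [simp]: "norm (harmonic n t) = 1"
  by (simp add: harmonic_def)

lemma harmonic_0 [simp]: "harmonic 0 = (\<lambda>_. 1)"
  by (simp add: harmonic_def fun_eq_iff)

lemma continuous_on_harmonic [continuous_intros]: "continuous_on S f \<Longrightarrow> continuous_on S (\<lambda>t. harmonic n (f t))"
  unfolding harmonic_def by (intro continuous_intros)

lemma harmonic_mult: "harmonic m t * harmonic n t = harmonic (m + n) t"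
  by (simp add: harmonic_def cis_mult algebra_simps)

lemma harmonic_add: "harmonic n (s + t) = harmonic n s * harmonic n t"
  by (simp add: harmonic_def cis_mult algebra_simps)

lemma harmonic_powi: "harmonic 1 t powi n = harmonic n t"
proof (cases n rule: int_cases2)
  case (nonneg k)
  then show ?thesis by (simp add: harmonic_def Complex.DeMoivre algebra_simps)
next
  case (nonpos k)
  then show ?thesis by (simp add: harmonic_def power_int_minus Complex.DeMoivre cis_cnj algebra_simps flip: cis_inverse)
qed

lemma harmonic_integer_shift: "harmonic n (1 + t) = harmonic n t"
  by (simp add: harmonic_def distrib_left flip: cis_mult)

lemma has_integral_harmonic: "(harmonic n has_integral (if n = 0 then 1 else 0)) {0..1}"
proof (cases "n = 0")
  case True
  then show ?thesis using has_integral_const_real[of "1 :: complex" 0 1] by simp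
next
  case False
  define c where "c = 2 * pi * of_int n * \<i>"
  define F where "F t = harmonic n t / c" for t
  have c: "c \<noteq> 0" using False by (simp add: c_def)
  have harm: "harmonic n t = exp (c * of_real t)" for t
    by (simp add: harmonic_def cis_conv_exp c_def algebra_simps)
  have "(F has_vector_derivative harmonic n t) (at t within {0..1})" for t
  proof -
    have "((\<lambda>z. exp (c * z) / c) has_field_derivative exp (c * of_real t)) (at (of_real t))"
      using c by (auto intro!: derivative_eq_intros)
    from has_vector_derivative_real_field[OF this] show ?thesis unfolding F_def harm .
  qed
  then have "(harmonic n has_integral F 1 - F 0) {0..1}"
    by (intro fundamental_theorem_of_calculus) auto
  moreover have "F 1 = F 0" using harmonic_integer_shift[of n 0] by (simp add: F_def)
  ultimately show ?thesis using False by simp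
qed

lemma integral_shift_periodic:
  fixes F :: "real \<Rightarrow> 'b :: banach"
  assumes cont: "continuous_on UNIV F" and per: "\<And>t. F (1 + t) = F t" and s: "0 \<le> s" "s \<le> 1"
  shows "integral {0..1} (\<lambda>t. F (s + t)) = integral {0..1} F"
proof -
  have int: "F integrable_on {a..b}" for a b
    by (intro integrable_continuous_real continuous_on_subset[OF cont]) auto
  have shift: "integral {a..b} (\<lambda>t. F (c + t)) = integral {a + c..b + c} F" for a b c
    using has_integral_affinity'[OF integrable_integral[OF int[of "a + c" "b + c", folded cbox_interval]], of 1 c]
    by (intro integral_unique) (simp add: add.commute)
  have "integral {0..1} (\<lambda>t. F (s + t)) = integral {s..1 + s} F"
    using shift[of 0 1 s] by simp
  also have "\<dots> = integral {s..1} F + integral {1..1 + s} F"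
    using s Henstock_Kurzweil_Integration.integral_combine[where a = s and c = 1 and b = "1 + s" and f = F, OF _ _ int] by simp
  also have "integral {1..1 + s} F = integral {0..s} (\<lambda>t. F (1 + t))"
    using shift[of 0 s 1] by (simp add: add.commute)
  also have "integral {s..1} F + integral {0..s} (\<lambda>t. F (1 + t)) = integral {0..1} F"
    using s Henstock_Kurzweil_Integration.integral_combine[where a = 0 and c = s and b = 1 and f = F, OF _ _ int] by (simp add: per add.commute[of "integral {s..1} F"])
  finally show ?thesis .
qed

lemma sphere_harmonic:
  assumes "z \<in> sphere 0 1"
  obtains s where "0 \<le> s" "s \<le> 1" "z = harmonic 1 s"
proof
  show "0 \<le> Arg2pi z / (2 * pi)" "Arg2pi z / (2 * pi) \<le> 1"
    using Arg2pi[of z] by auto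
  show "z = harmonic 1 (Arg2pi z / (2 * pi))"
    using Arg2pi_eq[of z] assms by (simp add: harmonic_def cis_conv_exp)
qed

text \<open>
  The powers of this function, suitably normalised, are trigonometric polynomials that concentrate
  at the integers. They play the role of the Fejer kernels.
\<close>

definition kernel :: "real \<Rightarrow> real" where
  "kernel t = (cos (pi * t))\<^sup>2"

lemma kernel_nonneg [simp]: "0 \<le> kernel t" and kernel_le_1 [simp]: "kernel t \<le> 1"
  by (simp_all add: kernel_def abs_square_le_1)

lemma continuous_on_kernel [continuous_intros]: "continuous_on S f \<Longrightarrow> continuous_on S (\<lambda>t :: real. kernel (f t))"
  by (auto simp: kernel_def intro!: continuous_intros)

lemma kernel_harmonic:
  "complex_of_real (kernel t) = (2 * harmonic 0 t + harmonic 1 t + harmonic (- 1) t) / 4"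
proof -
  have "cos (2 * (pi * t)) = 2 * kernel t - 1" unfolding kernel_def by (rule cos_double_cos)
  then show ?thesis by (simp add: harmonic_def complex_eq_iff algebra_simps)
qed

text \<open>
  Wallis' recursion for the integrals of \<open>cos\<^sup>2\<^sup>N\<close>, from the derivative of
  \<open>sin (\<pi> t) cos (\<pi> t)\<^sup>2\<^sup>N\<^sup>+\<^sup>1\<close>. It shows that the mass of \<open>kernel\<^sup>N\<close> away from the integers, as
  measured by \<open>1 - kernel\<close>, is negligible.
\<close>

lemma kernel_integral:
  "integral {0..1} (\<lambda>t. kernel t ^ N * (1 - kernel t)) = integral {0..1} (\<lambda>t. kernel t ^ N) / (2 * real N + 2)"
  "0 < integral {0..1} (\<lambda>t. kernel t ^ N)"
proof -
  define I where "I N = integral {0..1} (\<lambda>t. kernel t ^ N)" for N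
  have I: "((\<lambda>t. kernel t ^ N) has_integral I N) {0..1}" for N
    unfolding I_def by (intro integrable_integral integrable_continuous_real continuous_intros)
  have D: "((\<lambda>t. pi * ((2 * real N + 2) * kernel t ^ Suc N - (2 * real N + 1) * kernel t ^ N)) has_integral
      (sin (pi * 1) * cos (pi * 1) ^ (2 * N + 1) - sin (pi * 0) * cos (pi * 0) ^ (2 * N + 1))) {0..1}" for N
  proof (rule fundamental_theorem_of_calculus[where f = "\<lambda>t. sin (pi * t) * cos (pi * t) ^ (2 * N + 1)"])
    fix t :: real
    have "((\<lambda>t. sin (pi * t) * cos (pi * t) ^ (2 * N + 1)) has_real_derivative
        pi * cos (pi * t) * cos (pi * t) ^ (2 * N + 1)
          - sin (pi * t) * ((2 * N + 1) * cos (pi * t) ^ (2 * N) * (pi * sin (pi * t)))) (at t within {0..1})"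
      by (rule derivative_eq_intros refl | simp)+
    also have "pi * cos (pi * t) * cos (pi * t) ^ (2 * N + 1)
          - sin (pi * t) * ((2 * N + 1) * cos (pi * t) ^ (2 * N) * (pi * sin (pi * t)))
        = pi * (kernel t ^ Suc N - (2 * real N + 1) * kernel t ^ N * (sin (pi * t))\<^sup>2)"
      by (simp add: kernel_def power_mult power2_eq_square algebra_simps)
    also have "\<dots> = pi * ((2 * real N + 2) * kernel t ^ Suc N - (2 * real N + 1) * kernel t ^ N)"
      by (simp add: kernel_def sin_squared_eq algebra_simps)
    finally show "((\<lambda>t. sin (pi * t) * cos (pi * t) ^ (2 * N + 1)) has_vector_derivative
        pi * ((2 * real N + 2) * kernel t ^ Suc N - (2 * real N + 1) * kernel t ^ N)) (at t within {0..1})"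
      by (simp add: has_real_derivative_iff_has_vector_derivative)
  qed simp
  have "((\<lambda>t. pi * ((2 * real N + 2) * kernel t ^ Suc N - (2 * real N + 1) * kernel t ^ N)) has_integral
      pi * ((2 * real N + 2) * I (Suc N) - (2 * real N + 1) * I N)) {0..1}" for N
    by (intro has_integral_mult_right has_integral_diff I)
  from has_integral_unique[OF this D] have rec: "(2 * real N + 2) * I (Suc N) = (2 * real N + 1) * I N" for N
    by simp
  have "integral {0..1} (\<lambda>t. kernel t ^ N * (1 - kernel t)) = I N - I (Suc N)"
    using has_integral_diff[OF I[of N] I[of "Suc N"]]
    by (intro integral_unique) (simp add: algebra_simps)
  also have "\<dots> = I N / (2 * real N + 2)" using rec[of N] by (simp add: field_simps)
  finally show "integral {0..1} (\<lambda>t. kernel t ^ N * (1 - kernel t)) = integral {0..1} (\<lambda>t. kernel t ^ N) / (2 * real N + 2)"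
    by (simp add: I_def)
  have "0 < I N"
  proof (induction N)
    case 0
    then show ?case by (simp add: I_def)
  next
    case (Suc N)
    have "0 < (2 * real N + 1) * I N" using Suc by simp
    then have "0 < (2 * real N + 2) * I (Suc N)" by (simp only: rec)
    then show ?case by (simp add: zero_less_mult_iff)
  qed
  then show "0 < integral {0..1} (\<lambda>t. kernel t ^ N)" by (simp add: I_def)
qed

section \<open>Fourier coefficients of an action of the circle\<close>

context cstar_dynamical_system
begin

abbreviation A :: "int \<Rightarrow> 'a set" where "A \<equiv> spectral_subspace \<alpha>"

definition orbit :: "'a \<Rightarrow> real \<Rightarrow> 'a" where
  "orbit x t = \<alpha> (harmonic 1 t) x"

definition spectral_projection :: "int \<Rightarrow> 'a \<Rightarrow> 'a" where
  "spectral_projection n x = integral {0..1} (\<lambda>t. harmonic (- n) t *\<^sub>C orbit x t)"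

lemma harmonic_in_sphere: "harmonic n t \<in> sphere 0 1"
  by simp

lemma action_hom:
  assumes "z \<in> sphere 0 1"
  shows "\<alpha> z (x + y) = \<alpha> z x + \<alpha> z y" "\<alpha> z (c *\<^sub>C x) = c *\<^sub>C \<alpha> z x"
    "\<alpha> z (x * y) = \<alpha> z x * \<alpha> z y" "\<alpha> z (star x) = star (\<alpha> z x)" "norm (\<alpha> z x) \<le> norm x"
    "bounded_linear (\<alpha> z)"
proof -
  note aut = automorphism[OF assms]
  show 1: "\<alpha> z (x + y) = \<alpha> z x + \<alpha> z y" and 2: "\<alpha> z (c *\<^sub>C x) = c *\<^sub>C \<alpha> z x"
    and "\<alpha> z (x * y) = \<alpha> z x * \<alpha> z y" "\<alpha> z (star x) = star (\<alpha> z x)" for x y c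
    using aut by (simp_all add: star_automorphism_def)
  show 3: "norm (\<alpha> z x) \<le> norm x" for x using star_automorphism_contractive[OF aut] .
  show "bounded_linear (\<alpha> z)"
    by (rule bounded_linear_intro[of _ 1]) (simp_all add: 1 2 3 scaleR_scaleC)
qed

lemma action_one: "\<alpha> 1 x = x"
proof -
  have "\<alpha> 1 (\<alpha> 1 x) = \<alpha> 1 x" using action_mult[of 1 1] by (simp add: fun_eq_iff)
  moreover have "inj (\<alpha> 1)" using automorphism[of 1] by (simp add: star_automorphism_def bij_is_inj)
  ultimately show ?thesis by (simp add: inj_eq)
qed

lemma orbit_hom:
  "orbit (x + y) t = orbit x t + orbit y t" "orbit (c *\<^sub>C x) t = c *\<^sub>C orbit x t"
  "orbit (x * y) t = orbit x t * orbit y t" "norm (orbit x t) \<le> norm x"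
  by (simp_all add: orbit_def action_hom)

lemma continuous_on_orbit [continuous_intros]:
  "continuous_on S f \<Longrightarrow> continuous_on S (\<lambda>t. orbit x (f t))"
  unfolding orbit_def
  by (rule continuous_on_compose2[OF norm_continuous]) (auto intro!: continuous_intros)

lemma orbit_shift: "orbit x (s + t) = \<alpha> (harmonic 1 s) (orbit x t)"
  using action_mult[of "harmonic 1 s" "harmonic 1 t"] by (simp add: orbit_def harmonic_add)

lemma continuous_on_harmonic_orbit: "continuous_on S (\<lambda>t. harmonic n t *\<^sub>C orbit x t)"
  by (intro continuous_intros)

lemma has_integral_spectral_projection:
  "((\<lambda>t. harmonic (- n) t *\<^sub>C orbit x t) has_integral spectral_projection n x) {0..1}"
  unfolding spectral_projection_def
  by (intro integrable_integral integrable_continuous_real continuous_on_harmonic_orbit)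

lemma spectral_projectionI:
  "((\<lambda>t. harmonic (- n) t *\<^sub>C orbit x t) has_integral y) {0..1} \<Longrightarrow> spectral_projection n x = y"
  using has_integral_spectral_projection has_integral_unique by blast

lemma spectral_projection_add:
  "spectral_projection n (x + y) = spectral_projection n x + spectral_projection n y"
  using has_integral_add[OF has_integral_spectral_projection has_integral_spectral_projection]
  by (intro spectral_projectionI) (simp add: orbit_hom scaleC_add_right)

lemma spectral_projection_scaleC:
  "spectral_projection n (c *\<^sub>C x) = c *\<^sub>C spectral_projection n x"
  using has_integral_linear[OF has_integral_spectral_projection bounded_linear_scaleC_right[of c]]
  by (intro spectral_projectionI) (simp add: orbit_hom scaleC_scaleC comp_def mult.commute)

lemma norm_spectral_projection: "norm (spectral_projection n x) \<le> norm x"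
proof -
  have "norm (harmonic (- n) t *\<^sub>C orbit x t) \<le> norm x" for t
    by (simp add: norm_scaleC orbit_hom)
  then have "norm (spectral_projection n x) \<le> norm x * Henstock_Kurzweil_Integration.content {0..1::real}"
    using has_integral_spectral_projection by (intro has_integral_bound_real[where S = "{}"]) auto
  then show ?thesis by simp
qed

lemma bounded_linear_spectral_projection: "bounded_linear (spectral_projection n)"
  by (rule bounded_linear_intro[of _ 1])
    (simp_all add: spectral_projection_add spectral_projection_scaleC scaleR_scaleC norm_spectral_projection)

lemma spectral_projection_diff:
  "spectral_projection n (x - y) = spectral_projection n x - spectral_projection n y"
  using bounded_linear.linear[OF bounded_linear_spectral_projection] by (rule linear_diff)

lemma spectral_projection_zero: "spectral_projection n 0 = 0"
  using bounded_linear.linear[OF bounded_linear_spectral_projection] by (rule linear_0)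

text \<open>
  Applying the action at \<open>harmonic 1 s\<close> translates the integrand by \<open>s\<close> and multiplies it by
  \<open>harmonic n s\<close>; the integral over a period does not see the translation.
\<close>

lemma spectral_projection_mem: "spectral_projection n x \<in> A n"
  unfolding spectral_subspace_def
proof (intro CollectI ballI)
  fix z :: complex assume "z \<in> sphere 0 1"
  then obtain s where s: "0 \<le> s" "s \<le> 1" "z = harmonic 1 s" using sphere_harmonic by blast
  define F where "F t = harmonic (- n) t *\<^sub>C orbit x t" for t
  have F: "(F has_integral spectral_projection n x) {0..1}"
    unfolding F_def by (rule has_integral_spectral_projection)
  have "\<alpha> z (F t) = harmonic n s *\<^sub>C F (s + t)" for t
  proof -
    have "harmonic n s * harmonic (- n) (s + t) = harmonic (- n) t"
      by (simp add: harmonic_add harmonic_mult flip: mult.assoc)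
    then show ?thesis
      by (simp only: F_def orbit_shift scaleC_scaleC s action_hom(2)[OF harmonic_in_sphere])
  qed
  then have "\<alpha> z (spectral_projection n x) = integral {0..1} (\<lambda>t. harmonic n s *\<^sub>C F (s + t))"
    using has_integral_linear[OF F action_hom(6)[OF \<open>z \<in> sphere 0 1\<close>]]
    by (intro integral_unique[symmetric]) (simp add: comp_def)
  also have "\<dots> = harmonic n s *\<^sub>C integral {0..1} (\<lambda>t. F (s + t))"
  proof -
    have "(\<lambda>t. F (s + t)) integrable_on {0..1}"
      unfolding F_def by (intro integrable_continuous_real continuous_intros)
    from integral_linear[OF this bounded_linear_scaleC_right] show ?thesis by (simp add: comp_def)
  qed
  also have "integral {0..1} (\<lambda>t. F (s + t)) = integral {0..1} F"
  proof (rule integral_shift_periodic)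
    show "continuous_on UNIV F" unfolding F_def by (intro continuous_intros)
    show "F (1 + t) = F t" for t
      by (simp only: F_def harmonic_integer_shift orbit_def)
  qed (use s in auto)
  also have "integral {0..1} F = spectral_projection n x" using F by (rule integral_unique)
  finally show "\<alpha> z (spectral_projection n x) = (z powi n) *\<^sub>C spectral_projection n x"
    by (simp only: s harmonic_powi)
qed

lemma orbit_spectral_subspace: "x \<in> A n \<Longrightarrow> orbit x t = harmonic n t *\<^sub>C x"
  unfolding spectral_subspace_def orbit_def using harmonic_powi[of t n] by simp

lemma spectral_projection_spectral_subspace:
  assumes "x \<in> A m"
  shows "spectral_projection n x = (if m = n then x else 0)"
proof (rule spectral_projectionI)
  have "((\<lambda>t. harmonic (m - n) t *\<^sub>C x) has_integral (if m - n = 0 then 1 else 0) *\<^sub>C x) {0..1}"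
    using has_integral_linear[OF has_integral_harmonic
        bounded_bilinear.bounded_linear_left[OF bounded_bilinear_scaleC]]
    by (simp only: comp_def)
  moreover have "harmonic (- n) t *\<^sub>C orbit x t = harmonic (m - n) t *\<^sub>C x" for t
    using assms by (simp add: orbit_spectral_subspace scaleC_scaleC harmonic_mult)
  ultimately show "((\<lambda>t. harmonic (- n) t *\<^sub>C orbit x t) has_integral (if m = n then x else 0)) {0..1}"
    by (auto simp: scaleC_one split: if_splits)
qed

lemma spectral_projection_mult_left:
  assumes "a \<in> A k"
  shows "spectral_projection n (a * x) = a * spectral_projection (n - k) x"
proof (rule spectral_projectionI)
  have "harmonic (- n) t *\<^sub>C orbit (a * x) t = a * (harmonic (- (n - k)) t *\<^sub>C orbit x t)" for t
    using assms by (simp add: orbit_hom orbit_spectral_subspace mult_scaleC_left mult_scaleC_right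
        scaleC_scaleC harmonic_mult)
  then show "((\<lambda>t. harmonic (- n) t *\<^sub>C orbit (a * x) t) has_integral a * spectral_projection (n - k) x) {0..1}"
    using has_integral_mult_right[OF has_integral_spectral_projection] by (simp only:)
qed

lemma spectral_projection_mult_right:
  assumes "a \<in> A k"
  shows "spectral_projection n (x * a) = spectral_projection (n - k) x * a"
proof (rule spectral_projectionI)
  have "harmonic (- n) t *\<^sub>C orbit (x * a) t = (harmonic (- (n - k)) t *\<^sub>C orbit x t) * a" for t
    using assms by (simp add: orbit_hom orbit_spectral_subspace mult_scaleC_left mult_scaleC_right
        scaleC_scaleC harmonic_mult)
  then show "((\<lambda>t. harmonic (- n) t *\<^sub>C orbit (x * a) t) has_integral spectral_projection (n - k) x * a) {0..1}"
    using has_integral_mult_left[OF has_integral_spectral_projection] by (simp only:)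
qed

lemma integral_kernel_orbit_mem:
  "integral {0..1} (\<lambda>t. complex_of_real (kernel t) ^ N *\<^sub>C orbit x t)
     \<in> cspan (range (\<lambda>n. spectral_projection n x))"
proof -
  define M where "M = cspan (range (\<lambda>n. spectral_projection n x))"
  have M: "csubspace M" by (simp add: M_def)
  define F where "F N m t = (complex_of_real (kernel t) ^ N * harmonic m t) *\<^sub>C orbit x t" for N m t
  have int: "(F N m has_integral integral {0..1} (F N m)) {0..1}" for N m
    unfolding F_def by (intro integrable_integral integrable_continuous_real continuous_intros)
  have "integral {0..1} (F N m) \<in> M" for m
  proof (induction N arbitrary: m)
    case 0
    have "F 0 m = (\<lambda>t. harmonic m t *\<^sub>C orbit x t)" by (simp add: F_def fun_eq_iff)
    then have "integral {0..1} (F 0 m) = spectral_projection (- m) x"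
      by (simp add: spectral_projection_def)
    then show ?case unfolding M_def by (simp add: complex_vector.span_base)
  next
    case (Suc N)
    have "F (Suc N) m t = (1/2) *\<^sub>C F N m t + (1/4) *\<^sub>C F N (m + 1) t + (1/4) *\<^sub>C F N (m - 1) t" for t
    proof -
      have "complex_of_real (kernel t) ^ Suc N * harmonic m t
          = 1/2 * (complex_of_real (kernel t) ^ N * (harmonic 0 t * harmonic m t))
          + 1/4 * (complex_of_real (kernel t) ^ N * (harmonic 1 t * harmonic m t))
          + 1/4 * (complex_of_real (kernel t) ^ N * (harmonic (- 1) t * harmonic m t))"
        by (simp only: power_Suc2 kernel_harmonic) (simp add: field_simps)
      then show ?thesis
        unfolding harmonic_mult F_def by (simp add: scaleC_add_left scaleC_scaleC add.commute)
    qed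
    then have "F (Suc N) m = (\<lambda>t. (1/2) *\<^sub>C F N m t + (1/4) *\<^sub>C F N (m + 1) t + (1/4) *\<^sub>C F N (m - 1) t)"
      by blast
    moreover have "((\<lambda>t. c *\<^sub>C F N m t) has_integral c *\<^sub>C integral {0..1} (F N m)) {0..1}" for c m
      using has_integral_linear[OF int bounded_linear_scaleC_right[of c]] by (simp add: comp_def)
    ultimately have "integral {0..1} (F (Suc N) m) = (1/2) *\<^sub>C integral {0..1} (F N m)
        + (1/4) *\<^sub>C integral {0..1} (F N (m + 1)) + (1/4) *\<^sub>C integral {0..1} (F N (m - 1))"
      by (simp add: integral_unique has_integral_add)
    then show ?case
      using Suc.IH complex_vector.subspace_add[OF M] complex_vector.subspace_scale[OF M] by simp
  qed
  moreover have "F N 0 = (\<lambda>t. complex_of_real (kernel t) ^ N *\<^sub>C orbit x t)"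
    by (simp add: F_def fun_eq_iff)
  ultimately show ?thesis unfolding M_def by metis
qed

text \<open>
  Near the integers continuity of the action applies. Elsewhere \<open>1 - kernel t\<close> is bounded below, being a
  quarter of the squared distance of \<open>harmonic 1 t\<close> from one, and the left side is at most \<open>2 * norm x\<close>.
\<close>

lemma orbit_near_kernel:
  assumes "e > 0"
  obtains K where "\<And>t. norm (orbit x t - x) \<le> e + K * (1 - kernel t)" "K \<ge> 0"
proof -
  have "\<exists>d>0. \<forall>z\<in>sphere 0 1. dist z 1 < d \<longrightarrow> dist (\<alpha> z x) (\<alpha> 1 x) < e"
    using norm_continuous[of x] assms unfolding continuous_on_iff by auto
  then obtain d where d: "d > 0" "\<And>z. z \<in> sphere 0 1 \<Longrightarrow> dist z 1 < d \<Longrightarrow> norm (\<alpha> z x - x) < e"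
    by (auto simp: action_one dist_norm)
  have "norm (orbit x t - x) \<le> e + (8 * norm x / d\<^sup>2) * (1 - kernel t)" for t
  proof (cases "dist (harmonic 1 t) 1 < d")
    case True
    then have "norm (orbit x t - x) < e" using d by (simp add: orbit_def)
    moreover have "0 \<le> (8 * norm x / d\<^sup>2) * (1 - kernel t)"
      by (intro mult_nonneg_nonneg) simp_all
    ultimately show ?thesis by linarith
  next
    case False
    have "d\<^sup>2 \<le> (dist (harmonic 1 t) 1)\<^sup>2" using False d(1) by (intro power_mono) auto
    also have "\<dots> = (cos (2 * (pi * t)) - 1)\<^sup>2 + (sin (2 * (pi * t)))\<^sup>2"
      by (simp add: mult.assoc harmonic_def dist_norm cmod_power2)
    also have "\<dots> = 2 - 2 * cos (2 * (pi * t))"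
      using sin_cos_squared_add2[of "2 * (pi * t)"] by (simp add: power2_diff)
    also have "\<dots> = 4 * (1 - kernel t)"
      by (simp only: cos_double_cos kernel_def) simp
    finally have *: "d\<^sup>2 \<le> 4 * (1 - kernel t)" .
    have "norm (orbit x t - x) \<le> norm (orbit x t) + norm x" by (rule norm_triangle_ineq4)
    also have "\<dots> \<le> 2 * norm x" using orbit_hom(4)[of x t] by simp
    also have "\<dots> = (2 * norm x / d\<^sup>2) * d\<^sup>2" using d(1) by simp
    also have "\<dots> \<le> (2 * norm x / d\<^sup>2) * (4 * (1 - kernel t))" by (intro mult_left_mono *) simp
    also have "\<dots> = (8 * norm x / d\<^sup>2) * (1 - kernel t)" by simp
    finally show ?thesis using assms by linarith
  qed
  then show ?thesis using that[of "8 * norm x / d\<^sup>2"] by simp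
qed

text \<open>
  Averaging the orbit of \<open>x\<close> against the normalised powers of the kernel approximates \<open>x\<close>, and each
  average is a finite combination of Fourier coefficients, because the powers of the kernel are trigonometric
  polynomials.
\<close>

lemma mem_closed_span_spectral_projections:
  "x \<in> closure (cspan (range (\<lambda>n. spectral_projection n x)))"
proof (unfold closure_approachable, intro allI impI)
  fix e :: real assume e: "e > 0"
  obtain K where K: "\<And>t. norm (orbit x t - x) \<le> e / 2 + K * (1 - kernel t)" "K \<ge> 0"
    using orbit_near_kernel[of "e / 2" x] e by auto
  obtain N :: nat where "K / e < N" using reals_Archimedean2 by blast
  then have N: "K / (2 * real N + 2) < e / 2" using e by (simp add: field_simps)
  define I where "I = integral {0..1} (\<lambda>t. kernel t ^ N)"
  have I: "I > 0" "((\<lambda>t. kernel t ^ N) has_integral I) {0..1}"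
    unfolding I_def by (rule kernel_integral, intro integrable_integral integrable_continuous_real continuous_intros)
  define T where "T = integral {0..1} (\<lambda>t. complex_of_real (kernel t) ^ N *\<^sub>C orbit x t)"
  have T: "((\<lambda>t. complex_of_real (kernel t) ^ N *\<^sub>C orbit x t) has_integral T) {0..1}"
    unfolding T_def by (intro integrable_integral integrable_continuous_real continuous_intros)
  have "((\<lambda>t. kernel t ^ N *\<^sub>R x) has_integral I *\<^sub>R x) {0..1}"
    using has_integral_linear[OF I(2) bounded_linear_scaleR_left[of x]] by (simp add: comp_def)
  from has_integral_diff[OF T this]
  have D: "((\<lambda>t. kernel t ^ N *\<^sub>R (orbit x t - x)) has_integral T - I *\<^sub>R x) {0..1}"
    by (simp add: scaleR_scaleC complex_vector.scale_right_diff_distrib)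
  have "norm (T - I *\<^sub>R x) \<le> integral {0..1} (\<lambda>t. e / 2 * kernel t ^ N + K * (kernel t ^ N * (1 - kernel t)))"
    unfolding integral_unique[OF D, symmetric]
  proof (rule integral_norm_bound_integral)
    show "(\<lambda>t. kernel t ^ N *\<^sub>R (orbit x t - x)) integrable_on {0..1}" using D by blast
    show "(\<lambda>t. e / 2 * kernel t ^ N + K * (kernel t ^ N * (1 - kernel t))) integrable_on {0..1}"
      by (intro integrable_continuous_real continuous_intros)
    fix t :: real
    have "kernel t ^ N * norm (orbit x t - x) \<le> kernel t ^ N * (e / 2 + K * (1 - kernel t))"
      by (intro mult_left_mono K) simp
    also have "\<dots> = e / 2 * kernel t ^ N + K * (kernel t ^ N * (1 - kernel t))" by (simp add: algebra_simps)
    finally show "norm (kernel t ^ N *\<^sub>R (orbit x t - x)) \<le> e / 2 * kernel t ^ N + K * (kernel t ^ N * (1 - kernel t))"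
      by simp
  qed
  also have "\<dots> = e / 2 * I + K * (I / (2 * real N + 2))"
  proof -
    have "((\<lambda>t. kernel t ^ N * (1 - kernel t)) has_integral I / (2 * real N + 2)) {0..1}"
      unfolding I_def kernel_integral(1)[symmetric]
      by (intro integrable_integral integrable_continuous_real continuous_intros)
    then show ?thesis
      by (intro integral_unique has_integral_add has_integral_mult_right I)
  qed
  also have "\<dots> < e * I"
  proof -
    have "K / (2 * real N + 2) * I < e / 2 * I" using N I(1) by (rule mult_strict_right_mono)
    then have "e / 2 * I + K / (2 * real N + 2) * I < e / 2 * I + e / 2 * I"
      by (rule add_strict_left_mono)
    moreover have "K / (2 * real N + 2) * I = K * (I / (2 * real N + 2))" by simp
    ultimately show ?thesis by (simp only:)
  qed
  finally have "norm (T - I *\<^sub>R x) < e * I" .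
  moreover have "dist ((1 / I) *\<^sub>R T) x = norm (T - I *\<^sub>R x) / I"
  proof -
    have "(1 / I) *\<^sub>R T - x = (1 / I) *\<^sub>R (T - I *\<^sub>R x)" using I(1) by (simp add: algebra_simps)
    then show ?thesis using I(1) by (simp add: dist_norm)
  qed
  ultimately have "dist ((1 / I) *\<^sub>R T) x < e" using I(1) by (simp add: pos_divide_less_eq)
  moreover have "(1 / I) *\<^sub>R T \<in> cspan (range (\<lambda>n. spectral_projection n x))"
    unfolding T_def scaleR_scaleC by (intro complex_vector.span_scale integral_kernel_orbit_mem)
  ultimately show "\<exists>y\<in>cspan (range (\<lambda>n. spectral_projection n x)). dist y x < e" by blast
qed

end

section \<open>Calculus of closed products\<close>

lemma csubspace_Collect_ball:
  "(\<And>i. i \<in> I \<Longrightarrow> csubspace {x. P i x}) \<Longrightarrow> csubspace {x. \<forall>i\<in>I. P i x}"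
  unfolding complex_vector.subspace_def by simp

lemma closed_Collect_ball:
  "(\<And>i. i \<in> I \<Longrightarrow> closed {x. P i x}) \<Longrightarrow> closed {x. \<forall>i\<in>I. P i x}"
  using closed_INT[of I "\<lambda>i. {x. P i x}"] by (simp add: Collect_ball_eq)

lemma products_mono: "X \<subseteq> X' \<Longrightarrow> Y \<subseteq> Y' \<Longrightarrow> X \<odot> Y \<subseteq> X' \<odot> Y'"
  unfolding products_def by (rule closed_span_mono) blast

lemma products_assoc: "(X \<odot> Y) \<odot> Z = X \<odot> Y \<odot> Z"
proof (rule antisym; rule products_minimal)
  have triple: "x * y * z \<in> X \<odot> Y \<odot> Z" "x * (y * z) \<in> (X \<odot> Y) \<odot> Z"
    if "x \<in> X" "y \<in> Y" "z \<in> Z" for x y z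
    using that products_mem[of y Y z Z] products_mem[of x X "y * z" "Y \<odot> Z"]
      products_mem[of x X y Y] products_mem[of "x * y" "X \<odot> Y" z Z]
    by (simp_all add: mult.assoc)
  show "w * z \<in> X \<odot> Y \<odot> Z" if w: "w \<in> X \<odot> Y" and z: "z \<in> Z" for w z
    using w unfolding products_def[of X Y]
    by (rule closed_span_mult_right) (use z triple in \<open>auto simp: csubspace_products closed_products\<close>)
  show "x * w \<in> (X \<odot> Y) \<odot> Z" if x: "x \<in> X" and w: "w \<in> Y \<odot> Z" for x w
    using w unfolding products_def[of Y Z]
    by (rule closed_span_mult_left) (use x triple in \<open>auto simp: csubspace_products closed_products\<close>)
qed (rule csubspace_products closed_products)+

lemma star_products:
  assumes "z \<in> X \<odot> Y" "\<And>x. x \<in> X \<Longrightarrow> star x \<in> X'" "\<And>y. y \<in> Y \<Longrightarrow> star y \<in> Y'"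
  shows "star z \<in> Y' \<odot> X'"
  using assms(1) unfolding products_def[of X Y]
  by (rule closed_span_star)
    (use assms in \<open>auto simp: star_mult csubspace_products closed_products intro!: products_mem\<close>)

lemma zero_subset_products: "{0} \<subseteq> X \<odot> Y"
  using complex_vector.subspace_0[OF csubspace_products] by blast

lemma products_closed_subalgebra: "closed_subalgebra B \<Longrightarrow> X \<subseteq> B \<Longrightarrow> Y \<subseteq> B \<Longrightarrow> X \<odot> Y \<subseteq> B"
  by (rule products_minimal) (auto simp: closed_subalgebra_def)

lemma star_mult_self_eq_0: "star x * x = 0 \<Longrightarrow> x = (0 :: 'a :: cstar_algebra)"
  using cstar_identity[of x] by simp

text \<open>
  A factorisation that replaces approximate units: with \<open>C = (x x\<^sup>*)\<^sup>2\<close> the hypothesis on approximants holds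
  without error.
\<close>

lemma mem_closure_self_products:
  fixes x :: "'a :: cstar_algebra"
  assumes V: "csubspace V" "closed V" "x \<in> V" "\<And>y. y \<in> V \<Longrightarrow> x * star x * y \<in> V"
  shows "x \<in> closure {x * star x * (x * star x) * y | y. y \<in> V}"
proof (rule mem_closed_if_accretive_approximants[OF V(1-3) closed_closure])
  fix \<eta> :: real assume "\<eta> > 0"
  let ?C = "x * star x * (x * star x)"
  have "norm (?C + star ?C - 2 *\<^sub>R ?C) \<le> \<eta>"
    using \<open>\<eta> > 0\<close> by (simp add: star_simps scaleR_2 mult.assoc)
  moreover have "?C * y \<in> V" if "y \<in> V" for y
    using V(4)[OF V(4)[OF that]] by (simp add: mult.assoc)
  moreover have "?C * y \<in> closure {?C * y | y. y \<in> V}" if "y \<in> V" for y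
    by (rule subsetD[OF closure_subset]) (use that in blast)
  ultimately show "\<exists>C. norm (C + star C - 2 *\<^sub>R ?C) \<le> \<eta> \<and>
      (\<forall>y\<in>V. C * y \<in> V \<and> C * y \<in> closure {?C * y | y. y \<in> V})" by blast
qed

section \<open>Spectral subspaces and analytic elements\<close>

context cstar_dynamical_system
begin

lemma spectral_subspace_eq_fixed: "A n = {x. spectral_projection n x - x \<in> {0}}"
proof (intro set_eqI iffI CollectI)
  fix x assume "x \<in> A n"
  then show "spectral_projection n x - x \<in> {0}"
    using spectral_projection_spectral_subspace[of x n n] by simp
next
  fix x assume "x \<in> {x. spectral_projection n x - x \<in> {0}}"
  then show "x \<in> A n" using spectral_projection_mem[of n x] by simp
qed

lemma csubspace_spectral_subspace: "csubspace (A n)"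
  unfolding spectral_subspace_eq_fixed
  by (rule csubspace_vimage)
    (simp_all add: spectral_projection_add spectral_projection_scaleC spectral_projection_zero
      complex_vector.scale_right_diff_distrib complex_vector.subspace_single_0)

lemma closed_spectral_subspace: "closed (A n)"
  unfolding spectral_subspace_eq_fixed
  by (intro closed_vimage_bounded_linear bounded_linear_sub bounded_linear_spectral_projection
      bounded_linear_ident closed_singleton)

lemma star_spectral_subspace: "x \<in> A n \<Longrightarrow> star x \<in> A (- n)"
proof (unfold spectral_subspace_def, intro CollectI ballI)
  fix z :: complex
  assume x: "x \<in> {x. \<forall>z\<in>sphere 0 1. \<alpha> z x = z powi n *\<^sub>C x}" and z: "z \<in> sphere 0 1"
  have "cnj (z powi n) = z powi (- n)"
  proof -
    have "cnj z = inverse z" using z divide_conv_cnj[of z 1] by (simp add: inverse_eq_divide)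
    then show ?thesis by (simp add: power_int_minus flip: power_int_inverse)
  qed
  then show "\<alpha> z (star x) = z powi (- n) *\<^sub>C star x"
    using x z by (simp add: action_hom star_scaleC)
qed

lemma mult_spectral_subspace: "x \<in> A m \<Longrightarrow> y \<in> A n \<Longrightarrow> x * y \<in> A (m + n)"
proof (unfold spectral_subspace_def, intro CollectI ballI)
  fix z :: complex
  assume "x \<in> {x. \<forall>z\<in>sphere 0 1. \<alpha> z x = z powi m *\<^sub>C x}"
    "y \<in> {x. \<forall>z\<in>sphere 0 1. \<alpha> z x = z powi n *\<^sub>C x}" and z: "z \<in> sphere 0 1"
  moreover have "z \<noteq> 0" using z by auto
  ultimately show "\<alpha> z (x * y) = z powi (m + n) *\<^sub>C (x * y)"
    by (simp add: action_hom mult_scaleC_left mult_scaleC_right scaleC_scaleC power_int_add)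
qed

lemma products_spectral_subspace: "A m \<odot> A n \<subseteq> A (m + n)"
  by (rule products_minimal)
    (auto intro: mult_spectral_subspace csubspace_spectral_subspace closed_spectral_subspace)

lemma zero_spectral_subspace: "{0} \<subseteq> A n"
  using complex_vector.subspace_0[OF csubspace_spectral_subspace] by blast

lemma spectral_subspace_trivial_minus: "A (- n) = {0} \<Longrightarrow> A n = {0}"
proof (rule antisym[OF _ zero_spectral_subspace], rule subsetI)
  fix x assume "A (- n) = {0}" "x \<in> A n"
  then have "star x = 0" using star_spectral_subspace[of x n] by simp
  then show "x \<in> {0}" using star_star[of x] by simp
qed

lemma spectral_subspaces_dense: "closure (cspan (\<Union>n. A n)) = UNIV"
proof -
  have "x \<in> closure (cspan (\<Union>n. A n))" for x
    using mem_closed_span_spectral_projections[of x]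
      closed_span_mono[of "range (\<lambda>n. spectral_projection n x)" "\<Union>n. A n"] spectral_projection_mem
    by blast
  then show ?thesis by blast
qed

lemma csubspace_projection_vimage: "csubspace V \<Longrightarrow> csubspace {x. spectral_projection n x \<in> V}"
  by (rule csubspace_vimage)
    (simp_all add: spectral_projection_add spectral_projection_scaleC spectral_projection_zero)

lemma closed_projection_vimage: "closed V \<Longrightarrow> closed {x. spectral_projection n x \<in> V}"
  by (intro closed_vimage_bounded_linear bounded_linear_spectral_projection)

lemma analytic_elements_eq_closed_span:
  "analytic_elements \<alpha> = closure (cspan (\<Union>n\<in>{0..}. A n))"
proof (rule antisym)
  show "analytic_elements \<alpha> \<subseteq> closure (cspan (\<Union>n\<in>{0..}. A n))"
    unfolding analytic_elements_def by (rule closed_span_mono) auto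
  have "A n \<subseteq> analytic_elements \<alpha>" if "n \<ge> 0" for n
  proof (cases "A n = {0}")
    case True
    then show ?thesis
      using complex_vector.subspace_0[OF csubspace_closed_span] by (auto simp: analytic_elements_def)
  next
    case False
    then have "A n \<subseteq> (\<Union>n\<in>{n \<in> arveson_spectrum \<alpha>. n \<ge> 0}. A n)"
      using that by (auto simp: arveson_spectrum_def)
    then show ?thesis using closed_span_superset[of "\<Union>n\<in>{n \<in> arveson_spectrum \<alpha>. n \<ge> 0}. A n"] unfolding analytic_elements_def by simp
  qed
  then show "closure (cspan (\<Union>n\<in>{0..}. A n)) \<subseteq> analytic_elements \<alpha>"
    by (intro closed_span_minimal) (auto simp: analytic_elements_def csubspace_closed_span)
qed

lemma analytic_elements_eq: "analytic_elements \<alpha> = {x. \<forall>n\<in>{..<0}. spectral_projection n x = 0}"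
proof (rule antisym)
  show "analytic_elements \<alpha> \<subseteq> {x. \<forall>n\<in>{..<0}. spectral_projection n x = 0}"
    unfolding analytic_elements_eq_closed_span
  proof (rule closed_span_minimal)
    show "csubspace {x. \<forall>n\<in>{..<0}. spectral_projection n x = 0}"
      using csubspace_projection_vimage[OF complex_vector.subspace_single_0]
      by (intro csubspace_Collect_ball) simp
    show "closed {x. \<forall>n\<in>{..<0}. spectral_projection n x = 0}"
      using closed_projection_vimage[OF closed_singleton[of 0]]
      by (intro closed_Collect_ball) simp
  qed (auto simp: spectral_projection_spectral_subspace)
  show "{x. \<forall>n\<in>{..<0}. spectral_projection n x = 0} \<subseteq> analytic_elements \<alpha>"
  proof
    fix x assume x: "x \<in> {x. \<forall>n\<in>{..<0}. spectral_projection n x = 0}"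
    have "spectral_projection n x \<in> closure (cspan (\<Union>n\<in>{0..}. A n))" for n
    proof (cases "n \<ge> 0")
      case True
      then show ?thesis
        using closed_span_superset[of "\<Union>n\<in>{0..}. A n"] spectral_projection_mem[of n x] by auto
    next
      case False
      then show ?thesis using x complex_vector.subspace_0[OF csubspace_closed_span] by auto
    qed
    then have "closure (cspan (range (\<lambda>n. spectral_projection n x))) \<subseteq> analytic_elements \<alpha>"
      unfolding analytic_elements_eq_closed_span
      by (intro closed_span_minimal) (auto simp: csubspace_closed_span)
    then show "x \<in> analytic_elements \<alpha>" using mem_closed_span_spectral_projections by blast
  qed
qed

lemma spectral_subspace_subset_analytic: "n \<ge> 0 \<Longrightarrow> A n \<subseteq> analytic_elements \<alpha>"
  unfolding analytic_elements_eq_closed_span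
  using closed_span_superset[of "\<Union>n\<in>{0..}. A n"] by auto

lemma closed_subalgebra_analytic: "closed_subalgebra (analytic_elements \<alpha>)"
proof -
  let ?S = "analytic_elements \<alpha>"
  have S: "csubspace ?S" "closed ?S"
    by (simp_all add: analytic_elements_eq_closed_span csubspace_closed_span)
  have gen: "x * y \<in> ?S" if "x \<in> (\<Union>n\<in>{0..}. A n)" "y \<in> (\<Union>n\<in>{0..}. A n)" for x y
  proof -
    obtain m n where "m \<ge> 0" "n \<ge> 0" "x \<in> A m" "y \<in> A n" using \<open>x \<in> _\<close> \<open>y \<in> _\<close> by auto
    then show ?thesis
      using mult_spectral_subspace[of x m y n] spectral_subspace_subset_analytic[of "m + n"] by auto
  qed
  have left: "x * y \<in> ?S" if x: "x \<in> (\<Union>n\<in>{0..}. A n)" and y: "y \<in> ?S" for x y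
    using y unfolding analytic_elements_eq_closed_span
    by (rule closed_span_mult_left) (use gen[OF x] S in \<open>auto simp: analytic_elements_eq_closed_span\<close>)
  have "x * y \<in> ?S" if x: "x \<in> ?S" and y: "y \<in> ?S" for x y
    using x unfolding analytic_elements_eq_closed_span
    by (rule closed_span_mult_right) (use left y S in \<open>auto simp: analytic_elements_eq_closed_span\<close>)
  with S show ?thesis by (simp add: closed_subalgebra_def)
qed

lemma spectral_subspace_factor: "A n \<subseteq> A n \<odot> A (- n) \<odot> A n"
proof
  fix x assume x: "x \<in> A n"
  then have xx: "x * star x \<in> A n \<odot> A (- n)"
    by (intro products_mem star_spectral_subspace)
  then have xx0: "x * star x \<in> A 0" using products_spectral_subspace[of n "- n"] by auto
  have "x \<in> closure {x * star x * (x * star x) * y | y. y \<in> A n}"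
    using mult_spectral_subspace[OF xx0, of _ n] x
    by (intro mem_closure_self_products csubspace_spectral_subspace closed_spectral_subspace) auto
  also have "\<dots> \<subseteq> (A n \<odot> A (- n)) \<odot> A n"
  proof (rule closure_minimal[OF _ closed_products], clarify)
    fix y assume "y \<in> A n"
    then have "x * star x * y \<in> A n" using mult_spectral_subspace[OF xx0, of y n] by simp
    from products_mem[OF xx this] show "x * star x * (x * star x) * y \<in> (A n \<odot> A (- n)) \<odot> A n"
      by (simp add: mult.assoc)
  qed
  finally show "x \<in> A n \<odot> A (- n) \<odot> A n" by (simp add: products_assoc)
qed

lemma products_fixed_absorb: "A 0 \<odot> A n \<subseteq> A n" "A n \<odot> A 0 \<subseteq> A n"
  using products_spectral_subspace[of 0 n] products_spectral_subspace[of n 0] by simp_all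

lemma closed_ideal_products_spectral: "closed_ideal (A n \<odot> A (- n)) (A 0)"
proof -
  have "A 0 \<odot> A n \<odot> A (- n) \<subseteq> A n \<odot> A (- n)"
    using products_mono[OF products_fixed_absorb(1)[of n] order_refl[of "A (- n)"]] by (simp add: products_assoc)
  moreover have "(A n \<odot> A (- n)) \<odot> A 0 \<subseteq> A n \<odot> A (- n)"
    using products_mono[OF order_refl[of "A n"] products_fixed_absorb(2)[of "- n"]] by (simp add: products_assoc)
  ultimately show ?thesis
    unfolding closed_ideal_def using products_spectral_subspace[of n "- n"]
    by (auto simp: csubspace_products closed_products intro: products_mem)
qed

lemma star_products_spectral: "x \<in> A n \<odot> A (- n) \<Longrightarrow> star x \<in> A n \<odot> A (- n)"
  by (erule star_products) (use star_spectral_subspace[of _ n] star_spectral_subspace[of _ "- n"] in auto)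

end

section \<open>Maximality implies simplicity\<close>

context cstar_dynamical_system
begin

context
  fixes d :: int
  assumes d: "d \<ge> 1" and nontriv: "A d \<noteq> {0}"
    and gap: "\<And>n. 1 \<le> n \<Longrightarrow> n < d \<Longrightarrow> A n = {0}"
begin

text \<open>
  The set \<open>E\<close> of left multipliers of \<open>D\<close> is a closed algebra containing the analytic elements, since \<open>D\<close> is
  closed under multiplication on the left by non-negative degrees. Multiplication by \<open>z * k\<close> lowers degrees by \<open>d\<close>,
  and the components it moves from non-negative to negative degree have degree less than
  \<open>d\<close>; by the gap only degree \<open>0\<close> occurs, and there \<open>k\<close> brings the component into \<open>K\<close>. Maximality therefore gives
  \<open>E = UNIV\<close>.
\<close>

lemma negative_subspace_absorbs_ideal:
  assumes K: "closed_ideal K (A 0)" and zk: "z \<in> A (- d)" "k \<in> K" "z * k \<noteq> 0"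
    and max: "maximal_closed_subalgebra (analytic_elements \<alpha>)" and m: "m \<ge> 1"
  shows "A (- m) \<subseteq> A (- m) \<odot> K"
proof -
  define D where "D = {x. \<forall>m\<in>{1..}. spectral_projection (- m) x \<in> A (- m) \<odot> K}"
  define E where "E = {y. \<forall>x\<in>D. y * x \<in> D}"
  have D: "csubspace D" "closed D"
    unfolding D_def
    by (intro csubspace_Collect_ball csubspace_projection_vimage csubspace_products,
        intro closed_Collect_ball closed_projection_vimage closed_products)
  have E: "csubspace E" "closed E"
    unfolding E_def
    by (intro csubspace_Collect_ball csubspace_vimage[OF D(1)],
        simp_all add: distrib_right mult_scaleC_left)
      (intro closed_Collect_ball closed_vimage_bounded_linear bounded_linear_mult_left D(2))
  have subE: "closed_subalgebra E"
    using E by (auto simp: closed_subalgebra_def E_def mult.assoc)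
  have pos: "A n \<subseteq> E" if n: "n \<ge> 0" for n
  proof -
    have "spectral_projection (- m) (y * x) \<in> A (- m) \<odot> K"
      if y: "y \<in> A n" and x: "x \<in> D" and m: "m \<ge> 1" for x y m
    proof -
      have "spectral_projection (- m) (y * x) = y * spectral_projection (- (m + n)) x"
        using spectral_projection_mult_left[OF y] by simp
      also have "\<dots> \<in> A n \<odot> A (- (m + n)) \<odot> K"
      proof (rule products_mem[OF y])
        have "m + n \<in> {1..}" using m n by simp
        with x show "spectral_projection (- (m + n)) x \<in> A (- (m + n)) \<odot> K"
          unfolding D_def by blast
      qed
      also have "\<dots> \<subseteq> A (- m) \<odot> K"
        using products_mono[OF products_spectral_subspace[of n "- (m + n)"] order_refl[of K]]
        by (simp add: products_assoc)
      finally show ?thesis .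
    qed
    then show ?thesis by (auto simp: E_def D_def)
  qed
  have SE: "analytic_elements \<alpha> \<subseteq> E"
    unfolding analytic_elements_eq_closed_span
    by (rule closed_span_minimal) (use pos E in auto)
  have "z * k \<in> E"
  proof -
    have k0: "k \<in> A 0" using K zk(2) by (auto simp: closed_ideal_def)
    have zkd: "z * k \<in> A (- d)" using mult_spectral_subspace[OF zk(1) k0] by simp
    have "spectral_projection (- m) (z * k * x) \<in> A (- m) \<odot> K" if x: "x \<in> D" and m: "m \<ge> 1" for x m
    proof -
      have eq: "spectral_projection (- m) (z * k * x) = z * k * spectral_projection (d - m) x"
        using spectral_projection_mult_left[OF zkd, of "- m" x] by simp
      consider "m < d" | "m = d" | "m > d" by linarith
      then show ?thesis
      proof cases
        case 1
        then have "spectral_projection (d - m) x = 0"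
          using spectral_projection_mem[of "d - m" x] gap[of "d - m"] m by simp
        then show ?thesis using eq complex_vector.subspace_0[OF csubspace_products] by simp
      next
        case 2
        have "k * spectral_projection 0 x \<in> K"
          using K zk(2) spectral_projection_mem[of 0 x] by (auto simp: closed_ideal_def)
        then show ?thesis using eq 2 zk(1) products_mem by (simp add: mult.assoc)
      next
        case 3
        then have "m - d \<in> {1..}" by simp
        then have "spectral_projection (- (m - d)) x \<in> A (- (m - d)) \<odot> K"
          using x unfolding D_def by blast
        then have "z * k * spectral_projection (d - m) x \<in> A (- d) \<odot> A (- (m - d)) \<odot> K"
          using zkd products_mem by simp
        also have "\<dots> \<subseteq> A (- m) \<odot> K"
          using products_mono[OF products_spectral_subspace[of "- d" "- (m - d)"] order_refl[of K]]
          by (simp add: products_assoc)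
        finally show ?thesis using eq by simp
      qed
    qed
    then show ?thesis by (auto simp: E_def D_def)
  qed
  moreover have "z * k \<notin> analytic_elements \<alpha>"
  proof -
    have k0: "k \<in> A 0" using K zk(2) by (auto simp: closed_ideal_def)
    have "spectral_projection (- d) (z * k) = z * k"
      using spectral_projection_spectral_subspace[OF mult_spectral_subspace[OF zk(1) k0], of "- d"] by simp
    moreover have "- d \<in> {..<0}" using d by simp
    ultimately show ?thesis using zk(3) unfolding analytic_elements_eq by force
  qed
  ultimately have "analytic_elements \<alpha> \<subset> E" using SE by blast
  then have EU: "E = UNIV" using max subE by (simp add: maximal_closed_subalgebra_def)
  have "x * u \<in> A (- m) \<odot> K" if x: "x \<in> A (- m)" and u: "u \<in> A 0" for x u
  proof -
    have "u \<in> D"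
      unfolding D_def using spectral_projection_spectral_subspace[OF u]
      by (auto simp: complex_vector.subspace_0[OF csubspace_products])
    then have "x * u \<in> D" using EU by (auto simp: E_def)
    moreover have "spectral_projection (- m) (x * u) = x * u"
      using spectral_projection_spectral_subspace[OF mult_spectral_subspace[OF x u], of "- m"] by simp
    moreover have "m \<in> {1..}" using m by simp
    ultimately show ?thesis unfolding D_def by force
  qed
  then have "A (- m) \<odot> A 0 \<subseteq> A (- m) \<odot> K"
    by (intro products_minimal csubspace_products closed_products)
  moreover have "A (- m) \<odot> A m \<odot> A (- m) \<subseteq> A (- m) \<odot> A 0"
    using products_mono[OF order_refl products_spectral_subspace[of m "- m"]] by simp
  ultimately show ?thesis using spectral_subspace_factor[of "- m"] by simp
qed

lemma ideal_contains_products: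
  assumes K: "closed_ideal K (A 0)" and zk: "z \<in> A (- d)" "k \<in> K" "z * k \<noteq> 0"
    and max: "maximal_closed_subalgebra (analytic_elements \<alpha>)" and m: "m \<ge> 1"
  shows "A m \<odot> A (- m) \<subseteq> K"
proof -
  have "A m \<odot> A (- m) \<subseteq> A m \<odot> A (- m) \<odot> K"
    by (intro products_mono order_refl negative_subspace_absorbs_ideal[OF assms])
  also have "\<dots> \<subseteq> A 0 \<odot> K"
    using products_mono[OF products_spectral_subspace[of m "- m"] order_refl[of K]]
    by (simp add: products_assoc)
  also have "\<dots> \<subseteq> K"
    using K by (intro products_minimal) (auto simp: closed_ideal_def)
  finally show ?thesis .
qed

text \<open>
  Everything follows from \<open>ideal_contains_products\<close>. Applied to \<open>J\<close> it gives one inclusion, applied to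
  the closed span of \<open>A n\<close> times \<open>A (- n)\<close> the other. An ideal \<open>I\<close> of \<open>J\<close> is first replaced by \<open>J \<odot> I \<odot> J\<close>, which is an
  ideal of the whole fixed point algebra; it contains \<open>(y\<^sup>* y)\<^sup>2\<close> for every \<open>y \<in> I\<close>.
\<close>

lemma simple_ideal_if_maximal:
  assumes max: "maximal_closed_subalgebra (analytic_elements \<alpha>)"
  defines "J \<equiv> A d \<odot> A (- d)"
  shows "simple_cstar_algebra J"
    and "\<And>n. n \<ge> 1 \<Longrightarrow> A n \<noteq> {0} \<Longrightarrow> A n \<odot> A (- n) = J"
proof -
  have ideal: "closed_ideal (A n \<odot> A (- n)) (A 0)" for n by (rule closed_ideal_products_spectral)
  have JJ: "closed_ideal J (A 0)" unfolding J_def by (rule ideal)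
  have minus: "A (- d) \<noteq> {0}" using nontriv spectral_subspace_trivial_minus by blast
  have annih: "A (- n) \<odot> J \<odot> Y \<subseteq> {0}" if "\<And>z y. z \<in> A (- d) \<Longrightarrow> y \<in> Y \<Longrightarrow> z * y = 0" for Y n
  proof -
    have "A (- d) \<odot> Y \<subseteq> {0}"
      using that by (intro products_minimal complex_vector.subspace_single_0) auto
    then have "(A (- n) \<odot> A d) \<odot> A (- d) \<odot> Y \<subseteq> (A (- n) \<odot> A d) \<odot> {0}"
      by (intro products_mono order_refl)
    also have "\<dots> \<subseteq> {0}"
      by (intro products_minimal complex_vector.subspace_single_0) auto
    finally show ?thesis by (simp add: J_def products_assoc)
  qed
  have sub: "A n \<odot> A (- n) \<subseteq> J" and absorb: "A (- n) \<subseteq> A (- n) \<odot> J" if n: "n \<ge> 1" for n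
  proof -
    have "\<exists>z\<in>A (- d). \<exists>k\<in>J. z * k \<noteq> 0"
    proof (rule ccontr)
      assume "\<not> ?thesis"
      then have "A (- d) \<odot> J \<subseteq> {0}"
        by (intro products_minimal complex_vector.subspace_single_0) auto
      then have "A (- d) \<subseteq> {0}"
        using spectral_subspace_factor[of "- d"] by (simp add: J_def)
      then show False using minus zero_spectral_subspace by blast
    qed
    then obtain z k where "z \<in> A (- d)" "k \<in> J" "z * k \<noteq> 0" by blast
    from ideal_contains_products[OF JJ this max n] negative_subspace_absorbs_ideal[OF JJ this max n]
    show "A n \<odot> A (- n) \<subseteq> J" "A (- n) \<subseteq> A (- n) \<odot> J" .
  qed
  show "A n \<odot> A (- n) = J" if n: "n \<ge> 1" "A n \<noteq> {0}" for n
  proof (rule antisym[OF sub[OF n(1)]])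
    have "\<exists>z\<in>A (- d). \<exists>k\<in>A n \<odot> A (- n). z * k \<noteq> 0"
    proof (rule ccontr)
      assume "\<not> ?thesis"
      then have *: "A (- n) \<odot> J \<odot> A n \<odot> A (- n) \<subseteq> {0}" by (intro annih) auto
      have "A (- n) \<subseteq> A (- n) \<odot> A n \<odot> A (- n)" using spectral_subspace_factor[of "- n"] by simp
      also have "\<dots> \<subseteq> (A (- n) \<odot> J) \<odot> A n \<odot> A (- n)"
        by (intro products_mono absorb n order_refl)
      also have "\<dots> \<subseteq> {0}" using * by (simp add: products_assoc)
      finally have "A (- n) = {0}" using zero_spectral_subspace by blast
      then show False using n(2) spectral_subspace_trivial_minus by blast
    qed
    then obtain z k where "z \<in> A (- d)" "k \<in> A n \<odot> A (- n)" "z * k \<noteq> 0" by blast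
    from ideal_contains_products[OF ideal this max d] show "J \<subseteq> A n \<odot> A (- n)" by (simp add: J_def)
  qed
  have J0: "J \<subseteq> A 0" using JJ by (simp add: closed_ideal_def)
  have Jstar: "star x \<in> J" if "x \<in> J" for x using that unfolding J_def by (rule star_products_spectral)
  have Jalg: "closed_subalgebra J" using JJ J0 by (auto simp: closed_ideal_def closed_subalgebra_def)
  have Jnz: "J \<noteq> {0}"
  proof
    assume "J = {0}"
    then have "A (- d) \<subseteq> A (- d) \<odot> {0}" using absorb[OF d] by simp
    also have "\<dots> \<subseteq> {0}" by (intro products_minimal complex_vector.subspace_single_0) auto
    finally show False using minus zero_spectral_subspace by blast
  qed
  have "I = J" if I: "closed_ideal I J" and Inz: "I \<noteq> {0}" for I
  proof (rule antisym)
    show IJ: "I \<subseteq> J" using I by (simp add: closed_ideal_def)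
    have "0 \<in> I" using I complex_vector.subspace_0 by (auto simp: closed_ideal_def)
    with Inz obtain y where y: "y \<in> I" "y \<noteq> 0" by blast
    define K where "K = J \<odot> I \<odot> J"
    have KI: "K \<subseteq> I"
      unfolding K_def
    proof (rule products_minimal)
      have "I \<odot> J \<subseteq> I" using I by (intro products_minimal) (auto simp: closed_ideal_def)
      then show "x * u \<in> I" if "x \<in> J" "u \<in> I \<odot> J" for x u
        using that I by (auto simp: closed_ideal_def)
    qed (use I in \<open>auto simp: closed_ideal_def\<close>)
    have K: "closed_ideal K (A 0)"
    proof -
      have "A 0 \<odot> J \<subseteq> J" "J \<odot> A 0 \<subseteq> J"
        using JJ by (intro products_minimal; simp add: closed_ideal_def)+
      then have "A 0 \<odot> K \<subseteq> K" "K \<odot> A 0 \<subseteq> K"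
        using products_mono[of "A 0 \<odot> J" J "I \<odot> J" "I \<odot> J"] products_mono[of "J \<odot> I" "J \<odot> I" "J \<odot> A 0" J]
        by (simp_all add: K_def products_assoc)
      then show ?thesis
        using KI IJ J0 unfolding closed_ideal_def
        by (auto simp: K_def csubspace_products closed_products intro: products_mem)
    qed
    define k where "k = star y * y * (star y * y)"
    have yJ: "y \<in> J" "star y \<in> J" using y IJ Jstar by auto
    have yyJ: "star y * y \<in> J" using yJ Jalg by (auto simp: closed_subalgebra_def)
    have "star y * y * (star y * y) = star y * (y * (star y * y))" by (simp add: mult.assoc)
    then have kK: "k \<in> K" unfolding K_def k_def using products_mem[OF yJ(2) products_mem[OF y(1) yyJ]] by simp
    have kstar: "star k = k" by (simp add: k_def star_simps)
    have "star y * y \<noteq> 0" using y star_mult_self_eq_0 by blast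
    then have knz: "k \<noteq> 0"
      using star_mult_self_eq_0[of "star y * y"] by (auto simp: k_def star_simps)
    have "\<exists>z\<in>A (- d). z * k \<noteq> 0"
    proof (rule ccontr)
      assume "\<not> ?thesis"
      then have *: "z * k = 0" if "z \<in> A (- d)" for z using that by blast
      have "u * k \<in> {0}" if "u \<in> J" for u
        using that unfolding J_def products_def
        by (rule closed_span_mult_right) (auto simp: * mult.assoc complex_vector.subspace_single_0)
      moreover have "k \<in> J" using kK KI IJ by blast
      ultimately have "star k * k = 0" by (simp add: kstar)
      then show False using knz star_mult_self_eq_0 by blast
    qed
    then obtain z where "z \<in> A (- d)" "z * k \<noteq> 0" by blast
    from ideal_contains_products[OF K this(1) kK this(2) max d]
    show "J \<subseteq> I" using KI by (simp add: J_def)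
  qed
  then show "simple_cstar_algebra J"
    using Jalg Jstar Jnz by (auto simp: simple_cstar_algebra_def)
qed

end

end

section \<open>Simplicity implies maximality\<close>

context cstar_dynamical_system
begin

text \<open>
  Without positive degrees there are no negative ones either, by taking adjoints, and then density of the spectral
  subspaces leaves only fixed points.
\<close>

lemma exists_positive_spectral_subspace:
  assumes "\<exists>z\<in>sphere 0 1. \<alpha> z \<noteq> id"
  obtains d :: int where "d \<ge> 1" "A d \<noteq> {0}" "\<And>n. 1 \<le> n \<Longrightarrow> n < d \<Longrightarrow> A n = {0}"
proof -
  have "\<exists>k::nat. k \<ge> 1 \<and> A (int k) \<noteq> {0}"
  proof (rule ccontr)
    assume "\<not> ?thesis"
    then have nat: "A (int k) = {0}" if "k \<ge> 1" for k using that by blast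
    have pos: "A n = {0}" if "n \<ge> 1" for n :: int using nat[of "nat n"] that by simp
    then have "A n \<subseteq> A 0" for n
    proof -
      consider "n \<ge> 1" | "n = 0" | "- n \<ge> 1" by linarith
      then have "n = 0 \<or> A n = {0}"
        using pos[of n] spectral_subspace_trivial_minus[OF pos[of "- n"]] by cases simp_all
      then show ?thesis using zero_spectral_subspace[of 0] by (metis order_refl)
    qed
    then have "closure (cspan (\<Union>n. A n)) \<subseteq> A 0"
      by (intro closed_span_minimal csubspace_spectral_subspace closed_spectral_subspace) auto
    then have "x \<in> A 0" for x using spectral_subspaces_dense by blast
    then have "\<alpha> z = id" if "z \<in> sphere 0 1" for z
      using that by (auto simp: spectral_subspace_def scaleC_one fun_eq_iff)
    with assms show False by blast
  qed
  then obtain k :: nat where k: "k \<ge> 1 \<and> A (int k) \<noteq> {0}"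
    and least: "\<And>j. j < k \<Longrightarrow> \<not> (j \<ge> 1 \<and> A (int j) \<noteq> {0})"
    unfolding exists_least_iff[of "\<lambda>k. k \<ge> 1 \<and> A (int k) \<noteq> {0}"] by blast
  have "A n = {0}" if "1 \<le> n" "n < int k" for n
    using least[of "nat n"] that by auto
  with k show ?thesis using that[of "int k"] by auto
qed

context
  fixes d :: int and J :: "'a set"
  assumes d: "d \<ge> 1" and nontriv: "A d \<noteq> {0}"
    and gap: "\<And>n. 1 \<le> n \<Longrightarrow> n < d \<Longrightarrow> A n = {0}"
    and J: "\<And>n. n \<ge> 1 \<Longrightarrow> A n \<noteq> {0} \<Longrightarrow> A n \<odot> A (- n) = J"
begin

lemma J_eq: "J = A d \<odot> A (- d)"
  using J d nontriv by simp

lemma J_fixed: "J \<subseteq> A 0"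
  using products_spectral_subspace[of d "- d"] by (simp add: J_eq)

lemma J_products: "J \<odot> J \<subseteq> J" "A 0 \<odot> J \<subseteq> J"
proof -
  show "A 0 \<odot> J \<subseteq> J"
    using products_mono[OF products_fixed_absorb(1)[of d] order_refl[of "A (- d)"]]
    by (simp add: J_eq products_assoc)
  then show "J \<odot> J \<subseteq> J" using products_mono[OF J_fixed order_refl[of J]] by blast
qed

text \<open>
  One copy of \<open>J\<close> can be split off on the left of \<open>A n\<close>, and since \<open>J\<close> is the same ideal for every
  degree, it can be rewritten in terms of degree \<open>d\<close>.
\<close>

lemma positive_spectral_subspace_factor:
  assumes "n \<ge> 1"
  shows "A n \<subseteq> A d \<odot> A (n - d)"
proof (cases "A n = {0}")
  case True
  then show ?thesis using zero_subset_products by simp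
next
  case False
  have "A n \<subseteq> J \<odot> A n"
    using spectral_subspace_factor[of n] J[OF assms False] by (simp flip: products_assoc)
  also have "\<dots> = A d \<odot> A (- d) \<odot> A n" by (simp add: J_eq products_assoc)
  also have "\<dots> \<subseteq> A d \<odot> A (n - d)"
    using products_spectral_subspace[of "- d" n] by (intro products_mono) auto
  finally show ?thesis .
qed

lemma positive_spectral_subspace_factor_analytic:
  assumes "n \<ge> 1"
  shows "A n \<subseteq> A d \<odot> analytic_elements \<alpha>"
proof (cases "n < d")
  case True
  then show ?thesis using gap[OF assms] zero_subset_products by simp
next
  case False
  then have "A d \<odot> A (n - d) \<subseteq> A d \<odot> analytic_elements \<alpha>"
    by (intro products_mono spectral_subspace_subset_analytic) auto
  then show ?thesis using positive_spectral_subspace_factor[OF assms] by blast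
qed

text \<open>
  For a homogeneous component of positive degree the correction is the component itself, for one of
  negative degree its adjoint, which leaves a skew-adjoint difference. Both corrections have positive degree and so
  factor through \<open>A d\<close>. As the claim is only real-linear, scalars are absorbed
  into the homogeneous components.
\<close>

lemma real_part_correction:
  fixes v :: 'a and \<epsilon> :: real
  assumes "\<epsilon> > 0"
  shows "\<exists>s\<in>A d \<odot> analytic_elements \<alpha>.
    norm ((v - s) + star (v - s) - (spectral_projection 0 v + star (spectral_projection 0 v))) \<le> \<epsilon>"
proof -
  let ?R = "A d \<odot> analytic_elements \<alpha>"
  define h where "h v = spectral_projection 0 v + star (spectral_projection 0 v)" for v
  have h_add: "h (u + v) = h u + h v" and h_diff: "h (u - v) = h u - h v" for u v
    by (simp_all add: h_def spectral_projection_add spectral_projection_diff star_simps)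
  have exact: "\<exists>s\<in>?R. (v - s) + star (v - s) = h v" if "v \<in> cspan (\<Union>n. A n)" for v
    using that
  proof (induction rule: complex_vector.span_induct_alt)
    case base
    show ?case
      using complex_vector.subspace_0[OF csubspace_products]
      by (intro bexI[of _ 0]) (auto simp: h_def spectral_projection_zero)
  next
    case (step c x y)
    then obtain s n where s: "s \<in> ?R" "(y - s) + star (y - s) = h y" and x: "x \<in> A n" by auto
    define w where "w = c *\<^sub>C x"
    have w: "w \<in> A n" unfolding w_def by (rule complex_vector.subspace_scale[OF csubspace_spectral_subspace x])
    have "\<exists>r\<in>?R. (w - r) + star (w - r) = h w"
    proof -
      consider "n \<ge> 1" | "n = 0" | "- n \<ge> 1" by linarith
      then show ?thesis
      proof cases
        case 1
        then have "h w = 0" by (simp add: h_def spectral_projection_spectral_subspace[OF w])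
        with 1 w positive_spectral_subspace_factor_analytic[of n] show ?thesis
          by (intro bexI[of _ w]) auto
      next
        case 2
        then have "h w = w + star w" by (simp add: h_def spectral_projection_spectral_subspace[OF w])
        then show ?thesis
          using complex_vector.subspace_0[OF csubspace_products] by (intro bexI[of _ 0]) auto
      next
        case 3
        then have "h w = 0" by (auto simp: h_def spectral_projection_spectral_subspace[OF w])
        with 3 star_spectral_subspace[OF w] positive_spectral_subspace_factor_analytic[of "- n"] show ?thesis
          by (intro bexI[of _ "star w"]) (auto simp: star_simps)
      qed
    qed
    then obtain r where r: "r \<in> ?R" "(w - r) + star (w - r) = h w" by blast
    have "(w + y - (r + s)) + star (w + y - (r + s)) = ((w - r) + star (w - r)) + ((y - s) + star (y - s))"
      by (simp add: star_simps)
    also have "\<dots> = h (w + y)" by (simp add: r s h_add)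
    finally show ?case
      using complex_vector.subspace_add[OF csubspace_products r(1) s(1)] unfolding w_def by blast
  qed
  have "v \<in> closure (cspan (\<Union>n. A n))" using spectral_subspaces_dense by simp
  then obtain u where u: "u \<in> cspan (\<Union>n. A n)" "dist u v < \<epsilon> / 4"
    using assms unfolding closure_approachable by (meson divide_pos_pos zero_less_numeral)
  obtain s where s: "s \<in> ?R" "(u - s) + star (u - s) = h u" using exact[OF u(1)] by blast
  define x where "x = v - u"
  have nx: "norm x \<le> \<epsilon> / 4" using u(2) by (simp add: x_def dist_norm norm_minus_commute)
  have "(v - s) + star (v - s) - h v = x + star x - h x + ((u - s) + star (u - s) - h u)"
    by (simp add: x_def h_diff star_simps)
  also have "\<dots> = x + star x - spectral_projection 0 x - star (spectral_projection 0 x)"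
    by (simp add: s h_def)
  also have "norm \<dots> \<le> norm x + norm (star x) + norm (spectral_projection 0 x) + norm (star (spectral_projection 0 x))"
    by (rule norm_add_add_diff_diff_le)
  also have "\<dots> \<le> \<epsilon>" using nx norm_spectral_projection[of 0 x] by simp
  finally show ?thesis using s(1) unfolding h_def by blast
qed

text \<open>
  An element of \<open>B\<close> outside the analytic algebra has some coefficient \<open>c\<close> of negative degree \<open>- m\<close>. Multiplying by
  \<open>A (m - d)\<close> moves it to degree \<open>- d\<close>. It is not destroyed, since \<open>A m\<close> factors through \<open>A (m - d)\<close> and
  \<open>star c \<in> A m\<close> does not annihilate \<open>c\<close>.
\<close>

lemma superalgebra_has_lowest_coefficient:
  assumes B: "closed_subalgebra B" and SB: "analytic_elements \<alpha> \<subset> B"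
  obtains b where "b \<in> B" "spectral_projection (- d) b \<noteq> 0"
proof -
  obtain b where b: "b \<in> B" "b \<notin> analytic_elements \<alpha>" using SB by blast
  then obtain n where n: "n < 0" "spectral_projection n b \<noteq> 0" by (auto simp: analytic_elements_eq)
  define m where "m = - n"
  define c where "c = spectral_projection (- m) b"
  have m: "m \<ge> 1" and c: "c \<noteq> 0" "c \<in> A (- m)" "star c \<in> A m"
    using n star_spectral_subspace[of c "- m"] spectral_projection_mem[of "- m" b]
    by (auto simp: m_def c_def)
  have "A m \<noteq> {0}" using c(1,3) star_star[of c] by force
  then have md: "d \<le> m" using gap[of m] m by force
  have "\<exists>a\<in>A (m - d). a * c \<noteq> 0"
  proof (rule ccontr)
    assume "\<not> ?thesis"
    then have *: "a * c = 0" if "a \<in> A (m - d)" for a using that by blast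
    have "v * c \<in> {0}" if "v \<in> A d \<odot> A (m - d)" for v
      using that unfolding products_def
      by (rule closed_span_mult_right) (auto simp: * mult.assoc complex_vector.subspace_single_0)
    then have "star c * c = 0" using c(3) positive_spectral_subspace_factor[OF m] by blast
    then show False using c(1) star_mult_self_eq_0 by blast
  qed
  then obtain a where a: "a \<in> A (m - d)" "a * c \<noteq> 0" by blast
  have "a \<in> B" using a(1) spectral_subspace_subset_analytic[of "m - d"] md SB by auto
  then have "a * b \<in> B" using B b(1) by (simp add: closed_subalgebra_def)
  moreover have "spectral_projection (- d) (a * b) = a * c"
    using spectral_projection_mult_left[OF a(1), of "- d" b] by (simp add: c_def)
  ultimately show ?thesis using a(2) that by simp
qed

text \<open>
  The left side is a closed ideal of the simple algebra \<open>J\<close>. It is non-zero because it contains \<open>(c\<^sup>* c)\<^sup>2\<close>.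
\<close>

lemma closed_ideal_generated_by_coefficient:
  assumes simple: "simple_cstar_algebra J" and c: "c \<in> A (- d)" "c \<noteq> 0"
  shows "A d \<odot> {c} \<odot> J = J"
proof -
  let ?I = "A d \<odot> {c} \<odot> J"
  have "?I \<subseteq> A d \<odot> A (- d) \<odot> J" using c by (intro products_mono order_refl) auto
  also have "\<dots> = J \<odot> J" by (simp add: J_eq products_assoc)
  finally have IJ: "?I \<subseteq> J" using J_products by blast
  have "J \<odot> ?I \<subseteq> ?I"
    using products_mono[OF products_mono[OF J_fixed order_refl[of "A d"], THEN order_trans, OF products_fixed_absorb(1)]
        order_refl[of "{c} \<odot> J"]]
    by (simp add: products_assoc)
  moreover have "?I \<odot> J \<subseteq> ?I"
    unfolding products_assoc by (intro products_mono order_refl J_products)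
  ultimately have "closed_ideal ?I J"
    using IJ by (auto simp: closed_ideal_def csubspace_products closed_products intro: products_mem)
  moreover have "?I \<noteq> {0}"
  proof -
    have cs: "star c \<in> A d" using star_spectral_subspace[OF c(1)] by simp
    have "star c * c \<in> J" unfolding J_eq using products_mem[OF cs c(1)] .
    then have "star c * (c * (star c * c)) \<in> ?I" using cs by (intro products_mem) auto
    moreover have "star c * (c * (star c * c)) = star (star c * c) * (star c * c)"
      by (simp add: star_simps mult.assoc)
    moreover have "star (star c * c) * (star c * c) \<noteq> 0"
      using c(2) star_mult_self_eq_0 by blast
    ultimately show ?thesis by force
  qed
  ultimately show ?thesis using simple by (auto simp: simple_cstar_algebra_def)
qed

text \<open>
  The zeroth coefficient of \<open>a * b * f\<close> is \<open>a * c * f\<close>, where \<open>c\<close> is the coefficient of \<open>b\<close> of degree \<open>- d\<close>, and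
  these elements span a dense subspace of \<open>J\<close>. Hence \<open>(x x\<^sup>*)\<^sup>2\<close> is approximated by zeroth coefficients of elements of the
  right ideal, and after \<open>real_part_correction\<close> by real parts of elements of it.
\<close>

lemma ideal_subset_right_ideal:
  assumes simple: "simple_cstar_algebra J"
    and B: "closed_subalgebra B" and SB: "analytic_elements \<alpha> \<subset> B"
  shows "J \<subseteq> A d \<odot> B"
proof
  let ?P = "spectral_projection 0" and ?R = "A d \<odot> B"
  have AdB: "A d \<subseteq> B" using spectral_subspace_subset_analytic[of d] d SB by auto
  have A0B: "A 0 \<subseteq> B" using spectral_subspace_subset_analytic[of 0] SB by auto
  have RB: "?R \<subseteq> B" using B AdB by (intro products_closed_subalgebra) auto
  have "?R \<odot> B \<subseteq> ?R"
    unfolding products_assoc by (intro products_mono order_refl products_closed_subalgebra[OF B])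
  then have RmB: "r * b \<in> ?R" if "r \<in> ?R" "b \<in> B" for r b using products_mem[OF that] by blast
  obtain b where b: "b \<in> B" "spectral_projection (- d) b \<noteq> 0"
    using superalgebra_has_lowest_coefficient[OF B SB] .
  define c where "c = spectral_projection (- d) b"
  have c: "c \<in> A (- d)" "c \<noteq> 0" using b spectral_projection_mem by (auto simp: c_def)
  have PR: "csubspace (closure (?P ` ?R))"
  proof (rule csubspace_closure)
    show "csubspace (?P ` ?R)"
      using csubspace_products[of "A d" B] unfolding complex_vector.subspace_def
      by (auto simp: spectral_projection_zero image_iff
          simp flip: spectral_projection_add spectral_projection_scaleC
          intro: bexI[of _ 0])
  qed
  have approx: "J \<subseteq> closure (?P ` ?R)"
  proof -
    have gen: "a * (c * f) \<in> closure (?P ` ?R)" if a: "a \<in> A d" and f: "f \<in> J" for a f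
    proof -
      have f0: "f \<in> A 0" using f J_fixed by blast
      have "?P (a * (b * f)) = a * (c * f)"
        using spectral_projection_mult_left[OF a, of 0 "b * f"] spectral_projection_mult_right[OF f0, of "- d" b]
        by (simp add: c_def)
      moreover have "a * (b * f) \<in> ?R"
        using a b f0 A0B B by (intro products_mem) (auto simp: closed_subalgebra_def)
      ultimately have "a * (c * f) \<in> ?P ` ?R" by (metis imageI)
      then show ?thesis by (rule subsetD[OF closure_subset])
    qed
    have "A d \<odot> {c} \<odot> J \<subseteq> closure (?P ` ?R)"
    proof (rule products_minimal[OF _ PR closed_closure])
      fix a w assume a: "a \<in> A d" and "w \<in> {c} \<odot> J"
      from this(2) show "a * w \<in> closure (?P ` ?R)"
        unfolding products_def[of "{c}"]
        by (rule closed_span_mult_left[OF _ _ PR closed_closure]) (use gen[OF a] in auto)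
    qed
    then show ?thesis using closed_ideal_generated_by_coefficient[OF simple c] by simp
  qed
  fix x assume x: "x \<in> J"
  have Jalg: "closed_subalgebra J" and Jstar: "star x \<in> J"
    using simple x by (auto simp: simple_cstar_algebra_def)
  define e where "e = x * star x * (x * star x)"
  have eJ: "e \<in> J" using x Jalg Jstar by (auto simp: e_def closed_subalgebra_def)
  have es: "star e = e" by (simp add: e_def star_simps mult.assoc)
  have Bsub: "csubspace B" "closed B" using B by (auto simp: closed_subalgebra_def)
  have xB: "x \<in> B" using x J_fixed A0B by blast
  show "x \<in> ?R"
  proof (rule mem_closed_if_accretive_approximants[OF Bsub xB closed_products])
    fix \<eta> :: real assume \<eta>: "\<eta> > 0"
    have "e \<in> closure (?P ` ?R)" using eJ approx by blast
    then obtain v where v: "v \<in> ?R" "dist (?P v) e < \<eta> / 4"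
      using \<eta> unfolding closure_approachable by (metis divide_pos_pos imageE zero_less_numeral)
    obtain s where s: "s \<in> A d \<odot> analytic_elements \<alpha>"
      "norm ((v - s) + star (v - s) - (?P v + star (?P v))) \<le> \<eta> / 2"
      using real_part_correction[of "\<eta> / 2" v] \<eta> by auto
    define C where "C = v - s"
    define p where "p = ?P v - e"
    have "s \<in> ?R" using s(1) products_mono[OF order_refl[of "A d"], of "analytic_elements \<alpha>" B] SB by blast
    then have CR: "C \<in> ?R" unfolding C_def
      by (intro complex_vector.subspace_diff[OF csubspace_products] v)
    have "C + star C - 2 *\<^sub>R e = (C + star C - (?P v + star (?P v))) + (p + star p)"
      by (simp add: p_def star_simps es scaleR_2)
    also have "norm \<dots> \<le> norm (C + star C - (?P v + star (?P v))) + (norm p + norm (star p))"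
      by (intro norm_triangle_mono norm_triangle_ineq order_refl)
    also have "\<dots> \<le> \<eta>" using s(2) v(2) by (simp add: C_def p_def dist_norm)
    finally have "norm (C + star C - 2 *\<^sub>R e) \<le> \<eta>" .
    moreover have "C * y \<in> B \<and> C * y \<in> ?R" if "y \<in> B" for y using RmB[OF CR that] RB by blast
    ultimately show "\<exists>C. norm (C + star C - 2 *\<^sub>R (x * star x * (x * star x))) \<le> \<eta> \<and> (\<forall>y\<in>B. C * y \<in> B \<and> C * y \<in> ?R)"
      unfolding e_def by blast
  qed
qed

text \<open>
  Once \<open>J\<close> lies in the right ideal generated by \<open>A d\<close>, multiplying on the left by \<open>A (- d)\<close> brings \<open>A (- d)\<close>
  into \<open>B\<close>. Lower degrees are reached by factoring out copies of \<open>A (- d)\<close>.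
\<close>

lemma maximal_if_simple_ideal:
  assumes simple: "simple_cstar_algebra J"
  shows "maximal_closed_subalgebra (analytic_elements \<alpha>)"
  unfolding maximal_closed_subalgebra_def
proof (intro conjI allI impI closed_subalgebra_analytic, elim conjE)
  fix B assume B: "closed_subalgebra B" and SB: "analytic_elements \<alpha> \<subset> B"
  have pos: "A n \<subseteq> B" if "n \<ge> 0" for n using spectral_subspace_subset_analytic[OF that] SB by blast
  have "A (- d) \<subseteq> A (- d) \<odot> J" using spectral_subspace_factor[of "- d"] by (simp add: J_eq)
  also have "\<dots> \<subseteq> A (- d) \<odot> A d \<odot> B"
    by (intro products_mono order_refl ideal_subset_right_ideal simple B SB)
  also have "\<dots> \<subseteq> A 0 \<odot> B"
    using products_mono[OF products_spectral_subspace[of "- d" d] order_refl[of B]] by (simp add: products_assoc)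
  also have "\<dots> \<subseteq> B" using pos[of 0] B by (intro products_closed_subalgebra) auto
  finally have dB: "A (- d) \<subseteq> B" .
  have "A (- int m) \<subseteq> B" if "m \<ge> 1" for m :: nat
    using that
  proof (induction m rule: less_induct)
    case (less m)
    show ?case
    proof
      fix x assume x: "x \<in> A (- int m)"
      then have sx: "star x \<in> A (int m)" using star_spectral_subspace by fastforce
      consider "int m < d" | "int m = d" | "int m > d" by linarith
      then show "x \<in> B"
      proof cases
        case 1
        then have "star x = 0" using gap[of "int m"] less.prems sx by auto
        then have "x = 0" using star_star[of x] by simp
        then show ?thesis using B complex_vector.subspace_0 by (auto simp: closed_subalgebra_def)
      next
        case 2
        then show ?thesis using x dB by auto
      next
        case 3
        define l where "l = nat (int m - d)"
        have l: "int l = int m - d" "l \<ge> 1" "l < m" using 3 d by (auto simp: l_def)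
        have "star x \<in> A d \<odot> A (int l)"
          using positive_spectral_subspace_factor[of "int m"] less.prems sx l by auto
        then have "star (star x) \<in> A (- int l) \<odot> A (- d)"
          by (rule star_products) (use star_spectral_subspace in auto)
        also have "\<dots> \<subseteq> B" using B dB less.IH[OF l(3,2)] by (intro products_closed_subalgebra)
        finally show ?thesis by (simp add: star_star)
      qed
    qed
  qed
  from this[of "nat (- n)" for n :: int] have neg: "A n \<subseteq> B" if "n \<le> - 1" for n using that by force
  have "A n \<subseteq> B" for n using pos[of n] neg[of n] by linarith
  then have "closure (cspan (\<Union>n. A n)) \<subseteq> B"
    using B by (intro closed_span_minimal) (auto simp: closed_subalgebra_def)
  then show "B = UNIV" using spectral_subspaces_dense by auto
qed

end

end

section \<open>The equivalence\<close>

theorem theorem13: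
  fixes \<alpha> :: "complex \<Rightarrow> 'a :: cstar_algebra \<Rightarrow> 'a"
  assumes "cstar_dynamical_system \<alpha>"
    and "\<exists>z\<in>sphere 0 1. \<alpha> z \<noteq> id"
  shows "(\<exists>J. J \<noteq> {0} \<and> closed_ideal J (fixed_point_algebra \<alpha>) \<and> simple_cstar_algebra J \<and>
            (\<forall>n\<in>arveson_spectrum \<alpha>. n \<ge> 1 \<longrightarrow>
               closure (set_product (spectral_subspace \<alpha> n) (spectral_subspace \<alpha> (- n))) = J))
         \<longleftrightarrow> maximal_closed_subalgebra (analytic_elements \<alpha>)"
proof -
  interpret cstar_dynamical_system \<alpha> by fact
  obtain d where d: "d \<ge> 1" "A d \<noteq> {0}" "\<And>n. 1 \<le> n \<Longrightarrow> n < d \<Longrightarrow> A n = {0}"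
    by (rule exists_positive_spectral_subspace[OF assms(2)]) (rule that)
  have products: "closure (set_product (A n) (A (- n))) = A n \<odot> A (- n)" for n
    by (rule closure_set_product[OF csubspace_spectral_subspace])
  show ?thesis
    unfolding fixed_point_algebra_def products
  proof
    assume "\<exists>J. J \<noteq> {0} \<and> closed_ideal J (A 0) \<and> simple_cstar_algebra J \<and>
      (\<forall>n\<in>arveson_spectrum \<alpha>. n \<ge> 1 \<longrightarrow> A n \<odot> A (- n) = J)"
    then obtain J where J: "simple_cstar_algebra J" "\<forall>n\<in>arveson_spectrum \<alpha>. n \<ge> 1 \<longrightarrow> A n \<odot> A (- n) = J"
      by blast
    show "maximal_closed_subalgebra (analytic_elements \<alpha>)"
    proof (rule maximal_if_simple_ideal[OF d _ J(1)])
      show "A n \<odot> A (- n) = J" if "n \<ge> 1" "A n \<noteq> {0}" for n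
        using J(2) that by (simp add: arveson_spectrum_def)
    qed
  next
    assume max: "maximal_closed_subalgebra (analytic_elements \<alpha>)"
    note J = simple_ideal_if_maximal[OF d max]
    show "\<exists>J. J \<noteq> {0} \<and> closed_ideal J (A 0) \<and> simple_cstar_algebra J \<and>
      (\<forall>n\<in>arveson_spectrum \<alpha>. n \<ge> 1 \<longrightarrow> A n \<odot> A (- n) = J)"
    proof (intro exI[of _ "A d \<odot> A (- d)"] conjI ballI impI)
      show "A d \<odot> A (- d) \<noteq> {0}" using J(1) by (simp add: simple_cstar_algebra_def)
    qed (use J closed_ideal_products_spectral in \<open>simp_all add: arveson_spectrum_def\<close>)
  qed
qed

end
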